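(* Let $N\ge 1$ and, for $i=1,\dots,N$, let $\Sigma_i=(\mathbb{R}^{n_i},\mathbb{R}^{m_i},\mathbb{R}^{p_i},\mathcal{U}_i,\mathcal{W}_i,f_i,\mathbb{R}^{q_{1i}},\mathbb{R}^{q_{2i}},h_{1i},h_{2i})$ and $\hat\Sigma_i=(\mathbb{R}^{\hat n_i},\mathbb{R}^{\hat m_i},\mathbb{R}^{\hat p_i},\hat{\mathcal{U}}_i,\hat{\mathcal{W}}_i,\hat f_i,\mathbb{R}^{q_{1i}},\mathbb{R}^{\hat q_{2i}},\hat h_{1i},\hat h_{2i})$ be control systems, and let $V_i$ be a storage function from $\hat\Sigma_i$ to $\Sigma_i$ with associated functions $\alpha_i,\eta_i,\rho_{i\mathrm{ext}}$ and matrices $W_i,\hat W_i,H_i$ and $X_i=\begin{bmatrix} X_i^{11} & X_i^{12} \\ X_i^{21} & X_i^{22} \end{bmatrix}$. Let $M$ be a coupling matrix of size $(\sum_i p_i)\times(\sum_i q_{2i})$ and let $\Sigma=\mathcal{I}(\Sigma_1,\dots,\Sigma_N)$ be the interconnected control system with coupling matrix $M$. Put $\tilde q=\sum_{i=1}^N q_{2i}$, $W=\mathrm{diag}(W_1,\dots,W_N)$, $\hat W=\mathrm{diag}(\hat W_1,\dots,\hat W_N)$, $H=\mathrm{diag}(H_1,\dots,H_N)$ (block diagonal), and for scalars $\mu_1,\dots,\mu_N$ put $$X(\mu_1X_1,\dots,\mu_NX_N)=\begin{bmatrix}\mathrm{diag}(\mu_1X_1^{11},\dots,\mu_NX_N^{11})&\mathrm{diag}(\mu_1X_1^{12},\dots,\mu_NX_N^{12})\\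 \mathrm{diag}(\mu_1X_1^{21},\dots,\mu_NX_N^{21})&\mathrm{diag}(\mu_1X_1^{22},\dots,\mu_NX_N^{22})\end{bmatrix}.$$ Suppose there exist $\mu_i\ge 0$, $i=1,\dots,N$, and a matrix $\hat M$ of appropriate dimension, i.e. of size $(\sum_i\hat p_i)\times(\sum_i\hat q_{2i})$, such that $$\begin{bmatrix}WM\\ I_{\tilde q}\end{bmatrix}^T X(\mu_1X_1,\dots,\mu_NX_N)\begin{bmatrix}WM\\ I_{\tilde q}\end{bmatrix}\preceq 0\qquad\text{and}\qquad WMH=\hat W\hat M .$$ Then $$V(x,\hat x)=\sum_{i=1}^N\mu_iV_i(x_i,\hat x_i),\qquad x=[x_1;\dots;x_N],\ \hat x=[\hat x_1;\dots;\hat x_N],$$ is a simulation function from the interconnected control system $\hat\Sigma=\mathcal{I}(\hat\Sigma_1,\dots,\hat\Sigma_N)$, with coupling matrix $\hat M$, to $\Sigma$.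
   Context: Notation: $\|\cdot\|$ is the Euclidean norm, $[x_1;\dots;x_N]$ denotes vertical concatenation, $I_{k}$ is the $k\times k$ identity matrix, and $\preceq$ is the semidefinite order on symmetric matrices. A function $\gamma:\mathbb{R}_{\ge0}\to\mathbb{R}_{\ge0}$ is of class $\mathcal{K}_\infty$ if it is continuous, strictly increasing, $\gamma(0)=0$ and $\gamma(r)\to\infty$ as $r\to\infty$; $0$ in $\mathcal{K}_\infty\cup\{0\}$ is the zero function. Control system: a tuple $\Sigma=(\mathbb{R}^{n},\mathbb{R}^m,\mathbb{R}^p,\mathcal{U},\mathcal{W},f,\mathbb{R}^{q_1},\mathbb{R}^{q_2},h_1,h_2)$, where $\mathbb{R}^n,\mathbb{R}^m,\mathbb{R}^p,\mathbb{R}^{q_1},\mathbb{R}^{q_2}$ are the state, external input, internal input, external output and internal output spaces; $\mathcal{U}$, $\mathcal{W}$ are subsets of the sets of all measurable functions from open intervals of $\mathbb{R}$ to $\mathbb{R}^m$ and $\mathbb{R}^p$ respectively; $f:\mathbb{R}^n\times\mathbb{R}^m\times\mathbb{R}^p\to\mathbb{R}^n$ is continuous and for every compact $\mathsf D\subset\mathbb{R}^n$ there is a constant $Z>0$ with $\|f(x,u,w)-f(y,u,w)\|\le Z\|x-y\|$ for all $x,y\in\mathsf D$, $u\in\mathbb{R}^m$, $w\in\mathbb{R}^p$; $h_1:\mathbb{R}^n\to\mathbb{R}^{q_1}$ and $h_2:\mathbb{R}^n\to\mathbb{R}^{q_2}$ are the external and internal output maps. A system without internal inputs and outputs is written $(\mathbb{R}^n,\mathbb{R}^m,\mathcal{U},f,\mathbb{R}^q,h)$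 with $f:\mathbb{R}^n\times\mathbb{R}^m\to\mathbb{R}^n$, $h:\mathbb{R}^n\to\mathbb{R}^q$. Storage function: for control systems $\Sigma=(\mathbb{R}^{n},\mathbb{R}^m,\mathbb{R}^p,\mathcal{U},\mathcal{W},f,\mathbb{R}^{q_1},\mathbb{R}^{q_2},h_1,h_2)$ and $\hat\Sigma=(\mathbb{R}^{\hat n},\mathbb{R}^{\hat m},\mathbb{R}^{\hat p},\hat{\mathcal{U}},\hat{\mathcal{W}},\hat f,\mathbb{R}^{q_1},\mathbb{R}^{\hat q_2},\hat h_1,\hat h_2)$ (same external output dimension), a continuously differentiable $V:\mathbb{R}^n\times\mathbb{R}^{\hat n}\to\mathbb{R}_{\ge0}$ is a storage function from $\hat\Sigma$ to $\Sigma$ if there exist $\alpha,\eta\in\mathcal{K}_\infty$, $\rho_{\mathrm{ext}}\in\mathcal{K}_\infty\cup\{0\}$, matrices $W\in\mathbb{R}^{r\times p}$, $\hat W\in\mathbb{R}^{r\times\hat p}$, $H\in\mathbb{R}^{q_2\times\hat q_2}$ (for some $r$), and a symmetric matrix $X=\begin{bmatrix} X^{11} & X^{12} \\ X^{21} & X^{22} \end{bmatrix}\in\mathbb{R}^{(r+q_2)\times(r+q_2)}$, partitioned conformally, with $X^{22}\preceq0$, such that for all $x\in\mathbb{R}^n$, $\hat x\in\mathbb{R}^{\hat n}$: $\alpha(\|h_1(x)-\hat h_1(\hat x)\|)\le V(x,\hat x)$, and for every $\hat u\in\mathbb{R}^{\hat m}$ there is $u\in\mathbb{R}^m$ such that for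 all $\hat w\in\mathbb{R}^{\hat p}$, $w\in\mathbb{R}^p$, $$\nabla V(x,\hat x)^T\begin{bmatrix}f(x,u,w)\\ \hat f(\hat x,\hat u,\hat w)\end{bmatrix}\le-\eta(V(x,\hat x))+\rho_{\mathrm{ext}}(\|\hat u\|)+\begin{bmatrix}Ww-\hat W\hat w\\ h_2(x)-H\hat h_2(\hat x)\end{bmatrix}^TX\begin{bmatrix}Ww-\hat W\hat w\\ h_2(x)-H\hat h_2(\hat x)\end{bmatrix}.$$ Simulation function: for systems without internal inputs/outputs $\Sigma=(\mathbb{R}^n,\mathbb{R}^m,\mathcal{U},f,\mathbb{R}^q,h)$ and $\hat\Sigma=(\mathbb{R}^{\hat n},\mathbb{R}^{\hat m},\hat{\mathcal{U}},\hat f,\mathbb{R}^q,\hat h)$, a continuously differentiable $V:\mathbb{R}^n\times\mathbb{R}^{\hat n}\to\mathbb{R}_{\ge0}$ is a simulation function from $\hat\Sigma$ to $\Sigma$ if there exist $\alpha,\eta\in\mathcal{K}_\infty$ and $\rho_{\mathrm{ext}}\in\mathcal{K}_\infty\cup\{0\}$ such that for all $x\in\mathbb{R}^n$, $\hat x\in\mathbb{R}^{\hat n}$: $\alpha(\|h(x)-\hat h(\hat x)\|)\le V(x,\hat x)$, and for every $\hat u\in\mathbb{R}^{\hat m}$ there is $u\in\mathbb{R}^m$ with $$\nabla V(x,\hat x)^T\begin{bmatrix}f(x,u)\\ \hat f(\hat x,\hat u)\end{bmatrix}\le-\eta(V(x,\hat x))+\rho_{\mathrm{ext}}(\|\hat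 u\|).$$ Interconnection: given control systems $\Sigma_i$ as in the claim and a coupling matrix $M$, $\mathcal{I}(\Sigma_1,\dots,\Sigma_N)=(\mathbb{R}^n,\mathbb{R}^m,\mathcal{U},f,\mathbb{R}^q,h)$ has $n=\sum n_i$, $m=\sum m_i$, $q=\sum q_{1i}$, $f(x,u)=[f_1(x_1,u_1,w_1);\dots;f_N(x_N,u_N,w_N)]$, $h(x)=[h_{11}(x_1);\dots;h_{1N}(x_N)]$, where $x=[x_1;\dots;x_N]$, $u=[u_1;\dots;u_N]$ and the internal inputs are given by $[w_1;\dots;w_N]=M[h_{21}(x_1);\dots;h_{2N}(x_N)]$.
   Formalization: The weights are assumed to satisfy μ_i > 0 instead of μ_i ≥ 0: with a zero weight the claim fails (e.g. N = 1, μ_1 = 0 gives V = 0, which cannot bound α(‖h(x) − ĥ(x̂)‖) when the external outputs differ). *)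

theory Defs
  imports
    "HOL-Analysis.Analysis"
    "Jordan_Normal_Form.Matrix"
begin

unbundle no vec_syntax
no_notation inner (infix \<open>\<bullet>\<close> 70)

text \<open>
  The dimensions of the subsystems depend on their index, so \<open>\<real>\<^sup>n\<close> is rendered as
  \<^term>\<open>carrier_vec n\<close> for a natural number \<open>n\<close> (possibly \<open>0\<close>). Subsystems are indexed by \<open>i < N\<close>.
\<close>

section \<open>Euclidean space\<close>

definition vnorm :: "real vec \<Rightarrow> real" where
  "vnorm v = L2_set (\<lambda>j. v $ j) {..<dim_vec v}"

text \<open>
  On the carrier the distance is \<open>vnorm (v - w)\<close> (lemma \<open>euclid_dist_eq\<close>); that expression is
  not symmetric for vectors of different dimensions, which \<^locale>\<open>Metric_space\<close> does not allow.
\<close>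

definition euclid_dist :: "nat \<Rightarrow> real vec \<Rightarrow> real vec \<Rightarrow> real" where
  "euclid_dist n v w = L2_set (\<lambda>j. v $ j - w $ j) {..<n}"

definition euclid :: "nat \<Rightarrow> real vec topology" where
  "euclid n = Metric_space.mtopology (carrier_vec n) (euclid_dist n)"

lemma euclid_dist_eq:
  assumes "v \<in> carrier_vec n" "w \<in> carrier_vec n"
  shows "euclid_dist n v w = vnorm (v - w)"
  using assms unfolding euclid_dist_def vnorm_def by (auto intro!: L2_set_cong)

lemma Metric_space_euclid: "Metric_space (carrier_vec n) (euclid_dist n)"
proof
  fix x y z :: "real vec"
  show "0 \<le> euclid_dist n x y"
    by (simp add: euclid_dist_def)
  show "euclid_dist n x y = euclid_dist n y x"
    by (simp add: euclid_dist_def L2_set_def power2_commute)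
  assume xy: "x \<in> carrier_vec n" "y \<in> carrier_vec n"
  show "euclid_dist n x y = 0 \<longleftrightarrow> x = y"
    using xy by (auto simp: euclid_dist_def L2_set_eq_0_iff)
  assume z: "z \<in> carrier_vec n"
  show "euclid_dist n x z \<le> euclid_dist n x y + euclid_dist n y z"
    using L2_set_triangle_ineq[of "\<lambda>j. x $ j - y $ j" "\<lambda>j. y $ j - z $ j" "{..<n}"]
    by (simp add: euclid_dist_def)
qed

lemma topspace_euclid [simp]: "topspace (euclid n) = carrier_vec n"
  by (simp add: euclid_def Metric_space.topspace_mtopology[OF Metric_space_euclid])

section \<open>Differential calculus\<close>

definition line_through :: "nat \<Rightarrow> (real vec \<Rightarrow> real) \<Rightarrow> nat \<Rightarrow> real vec \<Rightarrow> real \<Rightarrow> real" where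
  "line_through k F j z = (\<lambda>t. F (z + t \<cdot>\<^sub>v unit_vec k j))"

definition partial_deriv :: "nat \<Rightarrow> (real vec \<Rightarrow> real) \<Rightarrow> nat \<Rightarrow> real vec \<Rightarrow> real" where
  "partial_deriv k F j z = deriv (line_through k F j z) 0"

definition gradient :: "nat \<Rightarrow> (real vec \<Rightarrow> real) \<Rightarrow> real vec \<Rightarrow> real vec" where
  "gradient k F z = vec k (\<lambda>j. partial_deriv k F j z)"

text \<open>Continuous differentiability on \<open>\<real>\<^sup>k\<close>: all partial derivatives exist and are continuous.\<close>

definition cont_differentiable :: "nat \<Rightarrow> (real vec \<Rightarrow> real) \<Rightarrow> bool" where
  "cont_differentiable k F \<longleftrightarrow>
     (\<forall>j<k. (\<forall>z\<in>carrier_vec k. line_through k F j z field_differentiable at 0) \<and>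
            continuous_map (euclid k) euclideanreal (partial_deriv k F j))"

text \<open>A function on \<open>\<real>\<^sup>n \<times> \<real>\<^bsup>nh\<^esup>\<close> seen as a function on \<open>\<real>\<^bsup>n+nh\<^esup>\<close>, so that its gradient is a stacked vector.\<close>

definition on_concat :: "nat \<Rightarrow> nat \<Rightarrow> (real vec \<Rightarrow> real vec \<Rightarrow> real) \<Rightarrow> real vec \<Rightarrow> real" where
  "on_concat n nh V z = V (vec_first z n) (vec_last z nh)"

section \<open>Comparison functions and semidefiniteness\<close>

text \<open>Functions on \<open>\<real>\<^sub>\<ge>\<^sub>0\<close> are functions on \<^typ>\<open>real\<close> whose values at negative arguments are irrelevant.\<close>

definition class_Kinf :: "(real \<Rightarrow> real) \<Rightarrow> bool" where
  "class_Kinf \<gamma> \<longleftrightarrow> continuous_on {0..} \<gamma> \<and> strict_mono_on {0..} \<gamma> \<and> \<gamma> 0 = 0 \<and>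
     filterlim \<gamma> at_top at_top"

definition class_Kinf_or_zero :: "(real \<Rightarrow> real) \<Rightarrow> bool" where
  "class_Kinf_or_zero \<gamma> \<longleftrightarrow> class_Kinf \<gamma> \<or> (\<forall>r\<ge>0. \<gamma> r = 0)"

definition symmetric_matrix :: "nat \<Rightarrow> real mat \<Rightarrow> bool" where
  "symmetric_matrix n A \<longleftrightarrow> A \<in> carrier_mat n n \<and> A\<^sup>T = A"

definition neg_semidef :: "nat \<Rightarrow> real mat \<Rightarrow> bool" where
  "neg_semidef n A \<longleftrightarrow> symmetric_matrix n A \<and> (\<forall>v\<in>carrier_vec n. v \<bullet> (A *\<^sub>v v) \<le> 0)"

section \<open>Control systems\<close>

type_synonym signal = "real \<rightharpoonup> real vec"

text \<open>
  A function on an open interval is a partial function whose domain is that interval (nonempty,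
  possibly unbounded); measurability is Lebesgue measurability of the components.
\<close>

definition measurable_signals :: "nat \<Rightarrow> signal set" where
  "measurable_signals m =
     {\<nu>. open (dom \<nu>) \<and> is_interval (dom \<nu>) \<and> dom \<nu> \<noteq> {} \<and> ran \<nu> \<subseteq> carrier_vec m \<and>
         (\<forall>j<m. (\<lambda>t. the (\<nu> t) $ j) \<in> borel_measurable (lebesgue_on (dom \<nu>)))}"

record system =
  n_of :: nat
  m_of :: nat
  p_of :: nat
  U_of :: "signal set"
  W_of :: "signal set"
  f_of :: "real vec \<Rightarrow> real vec \<Rightarrow> real vec \<Rightarrow> real vec"
  q1_of :: nat
  q2_of :: nat
  h1_of :: "real vec \<Rightarrow> real vec"
  h2_of :: "real vec \<Rightarrow> real vec"

definition control_system :: "system \<Rightarrow> bool" where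
  "control_system S \<longleftrightarrow>
     U_of S \<subseteq> measurable_signals (m_of S) \<and>
     W_of S \<subseteq> measurable_signals (p_of S) \<and>
     continuous_map
       (prod_topology (euclid (n_of S)) (prod_topology (euclid (m_of S)) (euclid (p_of S))))
       (euclid (n_of S)) (\<lambda>(x, u, w). f_of S x u w) \<and>
     (\<forall>D. compactin (euclid (n_of S)) D \<longrightarrow>
        (\<exists>Z>0. \<forall>x\<in>D. \<forall>y\<in>D. \<forall>u\<in>carrier_vec (m_of S). \<forall>w\<in>carrier_vec (p_of S).
           vnorm (f_of S x u w - f_of S y u w) \<le> Z * vnorm (x - y))) \<and>
     h1_of S \<in> carrier_vec (n_of S) \<rightarrow> carrier_vec (q1_of S) \<and>
     h2_of S \<in> carrier_vec (n_of S) \<rightarrow> carrier_vec (q2_of S)"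

text \<open>Systems without internal inputs and outputs.\<close>

record closed_system =
  cn_of :: nat
  cm_of :: nat
  cU_of :: "signal set"
  cf_of :: "real vec \<Rightarrow> real vec \<Rightarrow> real vec"
  cq_of :: nat
  ch_of :: "real vec \<Rightarrow> real vec"

section \<open>Storage and simulation functions\<close>

text \<open>
  \<open>storage_function_with Sh S V \<alpha> \<eta> \<rho> r W Wh H X11 X12 X21 X22\<close>: \<open>V\<close> is a storage function
  from \<open>Sh\<close> to \<open>S\<close>, witnessed by the remaining arguments. A trailing \<open>h\<close> stands for a hat.
\<close>

definition storage_function_with ::
  "system \<Rightarrow> system \<Rightarrow> (real vec \<Rightarrow> real vec \<Rightarrow> real) \<Rightarrow>
   (real \<Rightarrow> real) \<Rightarrow> (real \<Rightarrow> real) \<Rightarrow> (real \<Rightarrow> real) \<Rightarrow>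
   nat \<Rightarrow> real mat \<Rightarrow> real mat \<Rightarrow> real mat \<Rightarrow>
   real mat \<Rightarrow> real mat \<Rightarrow> real mat \<Rightarrow> real mat \<Rightarrow> bool" where
  "storage_function_with Sh S V \<alpha> \<eta> \<rho> r W Wh H X11 X12 X21 X22 \<longleftrightarrow>
     q1_of Sh = q1_of S \<and>
     (\<forall>x\<in>carrier_vec (n_of S). \<forall>xh\<in>carrier_vec (n_of Sh). 0 \<le> V x xh) \<and>
     cont_differentiable (n_of S + n_of Sh) (on_concat (n_of S) (n_of Sh) V) \<and>
     class_Kinf \<alpha> \<and> class_Kinf \<eta> \<and> class_Kinf_or_zero \<rho> \<and>
     W \<in> carrier_mat r (p_of S) \<and> Wh \<in> carrier_mat r (p_of Sh) \<and>
     H \<in> carrier_mat (q2_of S) (q2_of Sh) \<and>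
     X11 \<in> carrier_mat r r \<and> X12 \<in> carrier_mat r (q2_of S) \<and>
     X21 \<in> carrier_mat (q2_of S) r \<and> X22 \<in> carrier_mat (q2_of S) (q2_of S) \<and>
     symmetric_matrix (r + q2_of S) (four_block_mat X11 X12 X21 X22) \<and>
     neg_semidef (q2_of S) X22 \<and>
     (\<forall>x\<in>carrier_vec (n_of S). \<forall>xh\<in>carrier_vec (n_of Sh).
        \<alpha> (vnorm (h1_of S x - h1_of Sh xh)) \<le> V x xh \<and>
        (\<forall>uh\<in>carrier_vec (m_of Sh). \<exists>u\<in>carrier_vec (m_of S).
           \<forall>wh\<in>carrier_vec (p_of Sh). \<forall>w\<in>carrier_vec (p_of S).
             gradient (n_of S + n_of Sh) (on_concat (n_of S) (n_of Sh) V) (x @\<^sub>v xh) \<bullet>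
               (f_of S x u w @\<^sub>v f_of Sh xh uh wh)
             \<le> - \<eta> (V x xh) + \<rho> (vnorm uh) +
               (let z = (W *\<^sub>v w - Wh *\<^sub>v wh) @\<^sub>v (h2_of S x - H *\<^sub>v h2_of Sh xh)
                in z \<bullet> (four_block_mat X11 X12 X21 X22 *\<^sub>v z))))"

definition storage_function :: "system \<Rightarrow> system \<Rightarrow> (real vec \<Rightarrow> real vec \<Rightarrow> real) \<Rightarrow> bool" where
  "storage_function Sh S V \<longleftrightarrow>
     (\<exists>\<alpha> \<eta> \<rho> r W Wh H X11 X12 X21 X22.
        storage_function_with Sh S V \<alpha> \<eta> \<rho> r W Wh H X11 X12 X21 X22)"

text \<open>
  The bound \<open>\<alpha> (\<dots>) \<le> V x xh\<close> is why a weighted sum \<open>\<Sum>i<N. \<mu> i * V i\<close> needs \<open>\<mu> i > 0\<close>: the sum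
  with a zero weight does not control the output mismatch of that subsystem (for \<open>N = 1\<close> and
  \<open>\<mu> 0 = 0\<close> the bound would force the output maps to agree identically).
\<close>

definition simulation_function ::
  "closed_system \<Rightarrow> closed_system \<Rightarrow> (real vec \<Rightarrow> real vec \<Rightarrow> real) \<Rightarrow> bool" where
  "simulation_function Sh S V \<longleftrightarrow>
     cq_of Sh = cq_of S \<and>
     (\<forall>x\<in>carrier_vec (cn_of S). \<forall>xh\<in>carrier_vec (cn_of Sh). 0 \<le> V x xh) \<and>
     cont_differentiable (cn_of S + cn_of Sh) (on_concat (cn_of S) (cn_of Sh) V) \<and>
     (\<exists>\<alpha> \<eta> \<rho>. class_Kinf \<alpha> \<and> class_Kinf \<eta> \<and> class_Kinf_or_zero \<rho> \<and>
       (\<forall>x\<in>carrier_vec (cn_of S). \<forall>xh\<in>carrier_vec (cn_of Sh).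
          \<alpha> (vnorm (ch_of S x - ch_of Sh xh)) \<le> V x xh \<and>
          (\<forall>uh\<in>carrier_vec (cm_of Sh). \<exists>u\<in>carrier_vec (cm_of S).
             gradient (cn_of S + cn_of Sh) (on_concat (cn_of S) (cn_of Sh) V) (x @\<^sub>v xh) \<bullet>
               (cf_of S x u @\<^sub>v cf_of Sh xh uh)
             \<le> - \<eta> (V x xh) + \<rho> (vnorm uh))))"

section \<open>Interconnection\<close>

primrec concat_vecs :: "nat \<Rightarrow> (nat \<Rightarrow> real vec) \<Rightarrow> real vec" where
  "concat_vecs 0 xs = 0\<^sub>v 0"
| "concat_vecs (Suc N) xs = concat_vecs N xs @\<^sub>v xs N"

text \<open>The component \<open>x\<^sub>i\<close> of \<open>x = [x\<^sub>1; \<dots>; x\<^sub>N]\<close>, where \<open>x\<^sub>j\<close> has dimension \<open>d j\<close>.\<close>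

definition vec_block :: "(nat \<Rightarrow> nat) \<Rightarrow> nat \<Rightarrow> real vec \<Rightarrow> real vec" where
  "vec_block d i x = vec (d i) (\<lambda>j. x $ ((\<Sum>l<i. d l) + j))"

definition block_diag :: "nat \<Rightarrow> (nat \<Rightarrow> real mat) \<Rightarrow> real mat" where
  "block_diag N A = diag_block_mat (map A [0..<N])"

lemma dim_concat_vecs: "dim_vec (concat_vecs N xs) = (\<Sum>i<N. dim_vec (xs i))"
  by (induction N) auto

lemma vec_block_concat_vecs:
  assumes "i < N" and "\<And>j. j < N \<Longrightarrow> xs j \<in> carrier_vec (d j)"
  shows "vec_block d i (concat_vecs N xs) = xs i"
  using assms
proof (induction N)
  case (Suc N)
  have dim: "dim_vec (concat_vecs N xs) = (\<Sum>l<N. d l)"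
    using Suc.prems(2) by (auto simp: dim_concat_vecs intro!: sum.cong)
  show ?case
  proof (cases "i = N")
    case True
    then show ?thesis
      using Suc.prems(2)[of N] dim by (auto simp: vec_block_def)
  next
    case False
    then have "i < N" using Suc.prems by simp
    then have IH: "vec_block d i (concat_vecs N xs) = xs i"
      using Suc by simp
    have "(\<Sum>l<i. d l) + j < (\<Sum>l<N. d l)" if "j < d i" for j
    proof -
      have "(\<Sum>l<i. d l) + j < (\<Sum>l<Suc i. d l)" using that by simp
      also have "\<dots> \<le> (\<Sum>l<N. d l)"
        using \<open>i < N\<close> by (intro sum_mono2) auto
      finally show ?thesis .
    qed
    then have "vec_block d i (concat_vecs (Suc N) xs) = vec_block d i (concat_vecs N xs)"
      using dim by (auto simp: vec_block_def trans_less_add1 intro!: eq_vecI)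
    then show ?thesis using IH by simp
  qed
qed simp

text \<open>
  The external input signals of the interconnection are the \<open>[\<nu>\<^sub>1; \<dots>; \<nu>\<^sub>N]\<close> with \<open>\<nu>\<^sub>i\<close> an external
  input signal of the \<open>i\<close>-th subsystem, all on one common open interval.
\<close>

definition interconnection :: "nat \<Rightarrow> (nat \<Rightarrow> system) \<Rightarrow> real mat \<Rightarrow> closed_system" where
  "interconnection N S M =
     \<lparr> cn_of = (\<Sum>i<N. n_of (S i)),
       cm_of = (\<Sum>i<N. m_of (S i)),
       cU_of = {\<nu>. ran \<nu> \<subseteq> carrier_vec (\<Sum>i<N. m_of (S i)) \<and>
                   (\<forall>i<N. map_option (vec_block (\<lambda>j. m_of (S j)) i) \<circ> \<nu> \<in> U_of (S i))},
       cf_of = (\<lambda>x u.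
         let xb = (\<lambda>i. vec_block (\<lambda>j. n_of (S j)) i x);
             ub = (\<lambda>i. vec_block (\<lambda>j. m_of (S j)) i u);
             w = M *\<^sub>v concat_vecs N (\<lambda>i. h2_of (S i) (xb i));
             wb = (\<lambda>i. vec_block (\<lambda>j. p_of (S j)) i w)
         in concat_vecs N (\<lambda>i. f_of (S i) (xb i) (ub i) (wb i))),
       cq_of = (\<Sum>i<N. q1_of (S i)),
       ch_of = (\<lambda>x. concat_vecs N (\<lambda>i. h1_of (S i) (vec_block (\<lambda>j. n_of (S j)) i x))) \<rparr>"

end

theory Submission
  imports Defs
begin

text \<open>
  Summing the dissipation inequalities of the subsystems with weights \<open>\<mu>\<^sub>i\<close>, the supply rates add up to
  the quadratic form of \<open>X(\<mu>\<^sub>1X\<^sub>1, \<dots>, \<mu>\<^sub>NX\<^sub>N)\<close> at \<open>[W w - Wh wh; e]\<close> with \<open>e = h2(x) - H h2h(xh)\<close>. Inserting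
  \<open>w = M h2(x)\<close>, \<open>wh = Mh h2h(xh)\<close> and \<open>W M H = Wh Mh\<close> turns this vector into \<open>[W M; I] e\<close>, so the
  matrix inequality makes the sum nonpositive. What remains are comparison functions for the sum:
  since one of \<open>N\<close> nonnegative numbers is at least a fixed fraction of their sum, \<open>\<Sum>\<^sub>i \<kappa>\<^sub>i(a\<^sub>i)\<close> is
  bounded below by a \<open>K\<^sub>\<infinity>\<close> function of \<open>\<Sum>\<^sub>i a\<^sub>i\<close>.
\<close>

section \<open>Comparison functions\<close>

lemma class_Kinf_mono:
  assumes "class_Kinf \<gamma>" "0 \<le> a" "a \<le> b"
  shows "\<gamma> a \<le> \<gamma> b"
  using assms strict_mono_onD[of "{0..}" \<gamma> a b] by (cases "a = b") (auto simp: class_Kinf_def)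

lemma class_Kinf_nonneg:
  assumes "class_Kinf \<gamma>" "0 \<le> a"
  shows "0 \<le> \<gamma> a"
  using class_Kinf_mono[OF assms(1) order_refl assms(2)] assms(1) by (simp add: class_Kinf_def)

text \<open>Serves the two-term case of the lower bound for sums: a minimum stays below both
  candidates, whichever of the two terms turns out to be the larger.\<close>

lemma class_Kinf_min:
  assumes "class_Kinf \<gamma>" "class_Kinf \<delta>"
  shows "class_Kinf (\<lambda>s. min (\<gamma> s) (\<delta> s))"
  unfolding class_Kinf_def
proof (intro conjI)
  show "continuous_on {0..} (\<lambda>s. min (\<gamma> s) (\<delta> s))"
    using assms by (auto simp: class_Kinf_def intro!: continuous_on_min)
  show "strict_mono_on {0..} (\<lambda>s. min (\<gamma> s) (\<delta> s))"
    using assms unfolding class_Kinf_def strict_mono_on_def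
    by (simp add: min_less_iff_disj)
  show "min (\<gamma> 0) (\<delta> 0) = 0"
    using assms by (simp add: class_Kinf_def)
  show "filterlim (\<lambda>s. min (\<gamma> s) (\<delta> s)) at_top at_top"
    using assms by (simp add: class_Kinf_def filterlim_at_top eventually_conj)
qed

text \<open>The outer factor carries a weight; the inner factor is 1/2 when a sum is split in two
  and \<open>1 / \<mu> i\<close> when a weight has to be removed from an argument.\<close>

lemma class_Kinf_scale:
  assumes "class_Kinf \<gamma>" "0 < c" "0 < d"
  shows "class_Kinf (\<lambda>s. c * \<gamma> (d * s))"
  unfolding class_Kinf_def
proof (intro conjI)
  have "continuous_on {0..} \<gamma>" "(\<lambda>s. d * s) ` {0..} \<subseteq> {0..}"
    using assms by (auto simp: class_Kinf_def)
  then have "continuous_on {0..} (\<lambda>s. \<gamma> (d * s))"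
    by (rule continuous_on_compose2[OF _ continuous_on_mult_left[OF continuous_on_id]])
  then show "continuous_on {0..} (\<lambda>s. c * \<gamma> (d * s))"
    by (intro continuous_intros)
  show "strict_mono_on {0..} (\<lambda>s. c * \<gamma> (d * s))"
    using assms unfolding class_Kinf_def strict_mono_on_def by simp
  show "c * \<gamma> (d * 0) = 0"
    using assms by (simp add: class_Kinf_def)
  have scale: "filterlim (\<lambda>s. e * \<delta> s) at_top at_top"
    if "0 < e" "filterlim \<delta> at_top at_top" for e :: real and \<delta> :: "real \<Rightarrow> real"
    by (rule filterlim_tendsto_pos_mult_at_top[OF tendsto_const that])
  have "filterlim \<gamma> at_top at_top"
    using assms by (simp add: class_Kinf_def)
  then have "filterlim (\<lambda>s. \<gamma> (d * s)) at_top at_top"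
    by (rule filterlim_compose[OF _ scale[OF assms(3) filterlim_ident]])
  then show "filterlim (\<lambda>s. c * \<gamma> (d * s)) at_top at_top"
    by (rule scale[OF assms(2)])
qed

lemma class_Kinf_add:
  assumes "class_Kinf \<gamma>" "class_Kinf \<delta>"
  shows "class_Kinf (\<lambda>s. \<gamma> s + \<delta> s)"
  unfolding class_Kinf_def
proof (intro conjI)
  show "continuous_on {0..} (\<lambda>s. \<gamma> s + \<delta> s)"
    using assms by (auto simp: class_Kinf_def intro!: continuous_intros)
  show "strict_mono_on {0..} (\<lambda>s. \<gamma> s + \<delta> s)"
    using assms unfolding class_Kinf_def strict_mono_on_def by (simp add: add_strict_mono)
  show "\<gamma> 0 + \<delta> 0 = 0"
    using assms by (simp add: class_Kinf_def)
  show "filterlim (\<lambda>s. \<gamma> s + \<delta> s) at_top at_top"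
    using assms by (simp add: class_Kinf_def filterlim_at_top_add_at_top)
qed

text \<open>Every clause of \<open>class_Kinf\<close> looks only at nonnegative arguments or at the
  limit at infinity, so changing values at negative arguments is harmless.\<close>

lemma class_Kinf_cong:
  assumes "class_Kinf \<gamma>" "\<And>s. 0 \<le> s \<Longrightarrow> \<delta> s = \<gamma> s"
  shows "class_Kinf \<delta>"
proof -
  have "eventually (\<lambda>s. \<gamma> s = \<delta> s) at_top"
    using eventually_ge_at_top[of 0] by eventually_elim (simp add: assms(2))
  then have "filterlim \<delta> at_top at_top"
    using assms(1) filterlim_cong[of at_top at_top at_top at_top \<gamma> \<delta>] by (simp add: class_Kinf_def)
  then show ?thesis
    using assms(1) continuous_on_cong[of "{0..}" "{0..}" \<delta> \<gamma>]
    by (auto simp: class_Kinf_def strict_mono_on_def assms(2))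
qed

text \<open>One of two nonnegative summands is at least half of their sum.\<close>

lemma class_Kinf_le_sum:
  fixes N :: nat
  assumes "1 \<le> N" "\<And>i. i < N \<Longrightarrow> class_Kinf (\<kappa> i)"
  shows "\<exists>\<gamma>. class_Kinf \<gamma> \<and>
    (\<forall>a. (\<forall>i<N. 0 \<le> a i) \<longrightarrow> \<gamma> (\<Sum>i<N. a i) \<le> (\<Sum>i<N. \<kappa> i (a i)))"
  using assms
proof (induction N rule: nat_induct_at_least)
  case base
  then show ?case by (intro exI[of _ "\<kappa> 0"]) auto
next
  case (Suc N)
  have "\<And>i. i < N \<Longrightarrow> class_Kinf (\<kappa> i)"
    using Suc.prems by simp
  from Suc.IH[OF this] obtain \<gamma> where \<gamma>: "class_Kinf \<gamma>"
    "\<And>a. \<forall>i<N. 0 \<le> a i \<Longrightarrow> \<gamma> (\<Sum>i<N. a i) \<le> (\<Sum>i<N. \<kappa> i (a i))"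
    by blast
  \<comment> \<open>Half of \<open>s\<close> is a lower bound for the larger of two numbers with sum
    \<open>s\<close>; the minimum makes one function work for both cases.\<close>
  define \<delta> where "\<delta> s = min (\<gamma> (1/2 * s)) (\<kappa> N (1/2 * s))" for s
  have "\<delta> (\<Sum>i<Suc N. a i) \<le> (\<Sum>i<Suc N. \<kappa> i (a i))" if a: "\<forall>i<Suc N. 0 \<le> a i" for a
  proof -
    let ?s = "\<Sum>i<N. a i"
    have nn: "0 \<le> ?s" "0 \<le> a N" using a by (auto intro: sum_nonneg)
    have \<kappa>N: "class_Kinf (\<kappa> N)" using Suc.prems by simp
    have le: "\<delta> (?s + a N) \<le> \<gamma> (1/2 * (?s + a N))" "\<delta> (?s + a N) \<le> \<kappa> N (1/2 * (?s + a N))"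
      by (simp_all add: \<delta>_def)
    have pos: "0 \<le> \<gamma> ?s" "0 \<le> \<kappa> N (a N)"
      using class_Kinf_nonneg[OF \<gamma>(1) nn(1)] class_Kinf_nonneg[OF \<kappa>N nn(2)] by auto
    have "\<delta> (?s + a N) \<le> \<gamma> ?s + \<kappa> N (a N)"
    \<comment> \<open>The larger of the two terms dominates the bound by monotonicity, and the other
      one is discarded because it is nonnegative.\<close>
    proof (cases "a N \<le> ?s")
      case True
      then have "\<gamma> (1/2 * (?s + a N)) \<le> \<gamma> ?s"
        using nn by (intro class_Kinf_mono[OF \<gamma>(1)]) auto
      then show ?thesis using le pos by linarith
    next
      case False
      then have "\<kappa> N (1/2 * (?s + a N)) \<le> \<kappa> N (a N)"
        using nn by (intro class_Kinf_mono[OF \<kappa>N]) auto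
      then show ?thesis using le pos by linarith
    qed
    also have "\<gamma> ?s \<le> (\<Sum>i<N. \<kappa> i (a i))"
      using \<gamma>(2) a by simp
    finally show ?thesis by simp
  qed
  moreover have "class_Kinf \<delta>"
    unfolding \<delta>_def
    using class_Kinf_min[OF class_Kinf_scale[OF \<gamma>(1)] class_Kinf_scale[OF Suc.prems[of N]], of 1 "1/2" 1 "1/2"]
    by simp
  ultimately show ?case by blast
qed

lemma class_Kinf_or_zero_mono:
  assumes "class_Kinf_or_zero \<rho>" "0 \<le> a" "a \<le> b"
  shows "\<rho> a \<le> \<rho> b"
  using assms class_Kinf_mono[of \<rho> a b] by (auto simp: class_Kinf_or_zero_def)

lemma class_Kinf_or_zero_scale:
  assumes "class_Kinf_or_zero \<rho>" "0 < c"
  shows "class_Kinf_or_zero (\<lambda>s. c * \<rho> s)"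
  using assms class_Kinf_scale[of \<rho> c 1] by (auto simp: class_Kinf_or_zero_def)

text \<open>Unless both summands are of class K-infinity, one of them vanishes on the nonnegative
  reals, and there the sum coincides with the other.\<close>

lemma class_Kinf_or_zero_add:
  assumes "class_Kinf_or_zero \<rho>" "class_Kinf_or_zero \<sigma>"
  shows "class_Kinf_or_zero (\<lambda>s. \<rho> s + \<sigma> s)"
proof (cases "class_Kinf \<rho> \<and> class_Kinf \<sigma>")
  case True
  then show ?thesis by (simp add: class_Kinf_add class_Kinf_or_zero_def)
next
  case False
  then show ?thesis
    using assms class_Kinf_cong[of \<rho> "\<lambda>s. \<rho> s + \<sigma> s"] class_Kinf_cong[of \<sigma> "\<lambda>s. \<rho> s + \<sigma> s"]
    by (auto simp: class_Kinf_or_zero_def)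
qed

lemma class_Kinf_or_zero_sum:
  assumes "\<And>i. i < N \<Longrightarrow> class_Kinf_or_zero (\<rho> i)"
  shows "class_Kinf_or_zero (\<lambda>s. \<Sum>i<(N::nat). \<rho> i s)"
  using assms
proof (induction N)
  case 0
  then show ?case by (simp add: class_Kinf_or_zero_def)
next
  case (Suc N)
  then show ?case using class_Kinf_or_zero_add[of "\<lambda>s. \<Sum>i<N. \<rho> i s" "\<rho> N"] by simp
qed

section \<open>Vectors made of blocks\<close>

lemma concat_vecs_carrier [intro]:
  assumes "\<And>i. i < N \<Longrightarrow> xs i \<in> carrier_vec (d i)"
  shows "concat_vecs N xs \<in> carrier_vec (\<Sum>i<N. d i)"
  using assms by (intro carrier_vecI) (auto simp: dim_concat_vecs intro!: sum.cong)

lemma vec_block_carrier [simp, intro]: "vec_block d i x \<in> carrier_vec (d i)"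
  by (simp add: vec_block_def)

lemma concat_vecs_cong:
  assumes "\<And>i. i < N \<Longrightarrow> xs i = ys i"
  shows "concat_vecs N xs = concat_vecs N ys"
  using assms by (induction N) auto

lemma minus_append_vec:
  fixes a a' b b' :: "'a :: minus vec"
  assumes "dim_vec a = dim_vec a'" "dim_vec b = dim_vec b'"
  shows "(a @\<^sub>v b) - (a' @\<^sub>v b') = (a - a') @\<^sub>v (b - b')"
  using assms by (auto intro!: eq_vecI)

lemma concat_vecs_minus:
  assumes "\<And>i. i < N \<Longrightarrow> dim_vec (xs i) = dim_vec (ys i)"
  shows "concat_vecs N xs - concat_vecs N ys = concat_vecs N (\<lambda>i. xs i - ys i)"
  using assms by (induction N) (auto simp: minus_append_vec dim_concat_vecs intro!: eq_vecI)

lemma scalar_prod_concat_vecs: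
  fixes xs ys :: "nat \<Rightarrow> real vec"
  assumes "\<And>i. i < N \<Longrightarrow> dim_vec (xs i) = dim_vec (ys i)"
  shows "concat_vecs N xs \<bullet> concat_vecs N ys = (\<Sum>i<N. xs i \<bullet> ys i)"
  using assms
proof (induction N)
  case (Suc N)
  then show ?case
    by (simp add: scalar_prod_append[OF carrier_vecI[OF refl] carrier_vecI[OF refl] carrier_vecI carrier_vecI]
        dim_concat_vecs)
qed (simp add: scalar_prod_def)

lemma vnorm_nonneg [simp]: "0 \<le> vnorm v"
  by (simp add: vnorm_def)

text \<open>Squared norms add under concatenation, and the square root is subadditive.\<close>

lemma vnorm_append_le: "vnorm (a @\<^sub>v b) \<le> vnorm a + vnorm b"
proof -
  have split: "(\<Sum>j<m + n. f j) = (\<Sum>j<m. f j) + (\<Sum>j<n. f (m + j))" for f :: "nat \<Rightarrow> real" and m n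
    by (induction n) auto
  have "vnorm (a @\<^sub>v b) = sqrt (\<Sum>j<dim_vec a + dim_vec b. ((a @\<^sub>v b) $ j)\<^sup>2)"
    by (simp add: vnorm_def L2_set_def)
  also have "(\<Sum>j<dim_vec a + dim_vec b. ((a @\<^sub>v b) $ j)\<^sup>2) =
      (\<Sum>j<dim_vec a. (a $ j)\<^sup>2) + (\<Sum>j<dim_vec b. (b $ j)\<^sup>2)"
    by (subst split) (auto intro!: arg_cong2[where f = "(+)"] sum.cong)
  also have "sqrt \<dots> \<le> sqrt (\<Sum>j<dim_vec a. (a $ j)\<^sup>2) + sqrt (\<Sum>j<dim_vec b. (b $ j)\<^sup>2)"
    by (intro sqrt_add_le_add_sqrt sum_nonneg) auto
  finally show ?thesis by (simp add: vnorm_def L2_set_def)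
qed

text \<open>Turns the norm of the stacked output mismatch into a sum over subsystems, the shape to
  which \<open>class_Kinf_le_sum\<close> applies.\<close>

lemma vnorm_concat_vecs_le: "vnorm (concat_vecs N xs) \<le> (\<Sum>i<N. vnorm (xs i))"
proof (induction N)
  case (Suc N)
  then show ?case using vnorm_append_le[of "concat_vecs N xs" "xs N"] by simp
qed (simp add: vnorm_def)

text \<open>A position inside block \<open>i\<close> lies before the start of block
  \<open>i + 1\<close>, hence before the start of every later block. With a block index in place of
  \<open>N\<close> this separates two blocks.\<close>

lemma block_offset_less:
  fixes d :: "nat \<Rightarrow> nat"
  assumes "i < N" "j < d i"
  shows "(\<Sum>l<i. d l) + j < (\<Sum>l<N. d l)"
proof -
  have "(\<Sum>l<i. d l) + j < (\<Sum>l<Suc i. d l)" using assms by simp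
  also have "\<dots> \<le> (\<Sum>l<N. d l)" using assms by (intro sum_mono2) auto
  finally show ?thesis .
qed

text \<open>Consecutive blocks tile the coordinates: distinct blocks do not overlap, and induction
  on the number of blocks shows that no coordinate is missed.\<close>

lemma block_offset_bij:
  fixes d :: "nat \<Rightarrow> nat"
  shows "bij_betw (\<lambda>(i, j). (\<Sum>l<i. d l) + j) (SIGMA i:{..<N}. {..<d i}) {..<\<Sum>l<N. d l}"
proof (rule bij_betw_imageI)
  show "inj_on (\<lambda>(i, j). (\<Sum>l<i. d l) + j) (SIGMA i:{..<N}. {..<d i})"
  proof (rule inj_onI, clarsimp)
    fix i j i' j'
    assume "j < d i" "j' < d i'" and eq: "(\<Sum>l<i. d l) + j = (\<Sum>l<i'. d l) + j'"
    then have "\<not> i < i'" "\<not> i' < i"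
      using block_offset_less[of i i' j d] block_offset_less[of i' i j' d] by auto
    then show "i = i' \<and> j = j'" using eq by (cases i i' rule: linorder_cases) auto
  qed
  have "m \<in> (\<lambda>(i, j). (\<Sum>l<i. d l) + j) ` (SIGMA i:{..<N}. {..<d i})" if "m < (\<Sum>l<N. d l)" for m
    using that
  proof (induction N)
    case (Suc N)
    show ?case
    proof (cases "m < (\<Sum>l<N. d l)")
      case True
      then show ?thesis using Suc.IH by fastforce
    next
      case False
      then have "(N, m - (\<Sum>l<N. d l)) \<in> (SIGMA i:{..<Suc N}. {..<d i})"
        using Suc.prems by auto
      then show ?thesis using False by (force simp: image_iff)
    qed
  qed simp
  then show "(\<lambda>(i, j). (\<Sum>l<i. d l) + j) ` (SIGMA i:{..<N}. {..<d i}) = {..<\<Sum>l<N. d l}"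
    using block_offset_less by auto
qed

text \<open>The squares of the coordinates in one block form a part of the sum of all squares. This
  later bounds each component of the external input by the whole input.\<close>

lemma vnorm_vec_block_le:
  assumes "v \<in> carrier_vec (\<Sum>l<N. d l)" "i < N"
  shows "vnorm (vec_block d i v) \<le> vnorm v"
proof -
  have "(\<Sum>j<d i. (v $ ((\<Sum>l<i. d l) + j))\<^sup>2) = (\<Sum>m\<in>(\<lambda>j. (\<Sum>l<i. d l) + j) ` {..<d i}. (v $ m)\<^sup>2)"
    by (simp add: sum.reindex inj_on_def)
  also have "\<dots> \<le> (\<Sum>m<\<Sum>l<N. d l. (v $ m)\<^sup>2)"
    using block_offset_less[OF assms(2), of _ d] by (intro sum_mono2) auto
  finally show ?thesis
    using assms(1) by (simp add: vnorm_def L2_set_def vec_block_def)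
qed

text \<open>Every coordinate lies in some block, and the concatenation is known blockwise. Together
  with \<open>vec_block_concat_vecs\<close> this makes cutting and stacking mutually
  inverse.\<close>

lemma concat_vecs_vec_block:
  assumes "v \<in> carrier_vec (\<Sum>l<N. d l)"
  shows "concat_vecs N (\<lambda>i. vec_block d i v) = v"
proof (rule eq_vecI)
  show dim: "dim_vec (concat_vecs N (\<lambda>i. vec_block d i v)) = dim_vec v"
    using assms by (simp add: dim_concat_vecs vec_block_def)
  fix m assume "m < dim_vec v"
  then have "m \<in> (\<lambda>(i, j). (\<Sum>l<i. d l) + j) ` (SIGMA i:{..<N}. {..<d i})"
    using assms bij_betw_imp_surj_on[OF block_offset_bij[of d N]] by simp
  then obtain i j where ij: "i < N" "j < d i" "m = (\<Sum>l<i. d l) + j"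
    by auto
  have "vec_block d i (concat_vecs N (\<lambda>i. vec_block d i v)) $ j = vec_block d i v $ j"
    using ij by (subst vec_block_concat_vecs) auto
  then show "concat_vecs N (\<lambda>i. vec_block d i v) $ m = v $ m"
    using ij by (simp add: vec_block_def)
qed

section \<open>Block diagonal matrices\<close>

text \<open>The last block is split off, not the first, to match the recursion of
  \<open>concat_vecs\<close>.\<close>

lemma block_diag_Suc:
  "block_diag (Suc N) A = four_block_mat (block_diag N A)
     (0\<^sub>m (dim_row (block_diag N A)) (dim_col (A N)))
     (0\<^sub>m (dim_row (A N)) (dim_col (block_diag N A))) (A N)"
  by (simp add: block_diag_def diag_block_mat_last Let_def)

lemma block_diag_carrier [intro]:
  assumes "\<And>i. i < N \<Longrightarrow> A i \<in> carrier_mat (nr i) (nc i)"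
  shows "block_diag N A \<in> carrier_mat (\<Sum>i<N. nr i) (\<Sum>i<N. nc i)"
  using assms
proof (induction N)
  case 0
  then show ?case by (simp add: block_diag_def)
next
  case (Suc N)
  then have "block_diag N A \<in> carrier_mat (\<Sum>i<N. nr i) (\<Sum>i<N. nc i)" "A N \<in> carrier_mat (nr N) (nc N)"
    by auto
  then show ?case by (auto simp: block_diag_Suc)
qed

text \<open>Induction on the number of blocks; the zero blocks off the diagonal contribute zero
  vectors.\<close>

lemma block_diag_mult_concat_vecs:
  fixes A :: "nat \<Rightarrow> real mat"
  assumes "\<And>i. i < N \<Longrightarrow> A i \<in> carrier_mat (nr i) (nc i)"
    and "\<And>i. i < N \<Longrightarrow> xs i \<in> carrier_vec (nc i)"
  shows "block_diag N A *\<^sub>v concat_vecs N xs = concat_vecs N (\<lambda>i. A i *\<^sub>v xs i)"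
  using assms
proof (induction N)
  case 0
  then show ?case by (auto simp: block_diag_def intro!: eq_vecI)
next
  case (Suc N)
  have B: "block_diag N A \<in> carrier_mat (\<Sum>i<N. nr i) (\<Sum>i<N. nc i)"
    using Suc.prems by (intro block_diag_carrier) auto
  have A: "A N \<in> carrier_mat (nr N) (nc N)" and x: "xs N \<in> carrier_vec (nc N)"
    using Suc.prems by auto
  have c: "concat_vecs N xs \<in> carrier_vec (\<Sum>i<N. nc i)"
    using Suc.prems by (intro concat_vecs_carrier) auto
  have "block_diag (Suc N) A *\<^sub>v concat_vecs (Suc N) xs =
    (block_diag N A *\<^sub>v concat_vecs N xs + 0\<^sub>m (\<Sum>i<N. nr i) (nc N) *\<^sub>v xs N) @\<^sub>v
    (0\<^sub>m (nr N) (\<Sum>i<N. nc i) *\<^sub>v concat_vecs N xs + A N *\<^sub>v xs N)"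
    using A B unfolding block_diag_Suc concat_vecs.simps
    by (subst four_block_mat_mult_vec[OF B _ _ A c x]) auto
  also have "\<dots> = block_diag N A *\<^sub>v concat_vecs N xs @\<^sub>v A N *\<^sub>v xs N"
    using A B c x by auto
  finally show ?case using Suc by simp
qed

lemma smult_quadratic_form:
  fixes v w :: "real vec"
  assumes "A \<in> carrier_mat n m" "v \<in> carrier_vec n" "w \<in> carrier_vec m"
  shows "v \<bullet> ((c \<cdot>\<^sub>m A) *\<^sub>v w) = c * (v \<bullet> (A *\<^sub>v w))"
proof -
  have "(c \<cdot>\<^sub>m A) *\<^sub>v w = c \<cdot>\<^sub>v (A *\<^sub>v w)"
    using assms by (auto intro!: eq_vecI)
  then show ?thesis using assms by simp
qed

lemma quadratic_form_four_block:
  fixes A B C D :: "real mat"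
  assumes A: "A \<in> carrier_mat a a" and B: "B \<in> carrier_mat a b"
    and C: "C \<in> carrier_mat b a" and D: "D \<in> carrier_mat b b"
    and v: "v \<in> carrier_vec a" and w: "w \<in> carrier_vec b"
  shows "(v @\<^sub>v w) \<bullet> (four_block_mat A B C D *\<^sub>v (v @\<^sub>v w)) =
    v \<bullet> (A *\<^sub>v v) + v \<bullet> (B *\<^sub>v w) + (w \<bullet> (C *\<^sub>v v) + w \<bullet> (D *\<^sub>v w))"
proof -
  note c = mult_mat_vec_carrier[OF A v] mult_mat_vec_carrier[OF B w]
    mult_mat_vec_carrier[OF C v] mult_mat_vec_carrier[OF D w]
  show ?thesis
    unfolding four_block_mat_mult_vec[OF A B C D v w]
    using v w c
    by (simp add: scalar_prod_append[of _ a _ b] scalar_prod_add_distrib[of _ a] scalar_prod_add_distrib[of _ b])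
qed

text \<open>This is how the weighted supply rates add up. The two sides group the same coordinates
  differently, all \<open>v i\<close> before all \<open>w i\<close> or pair by pair; after expansion
  into four bilinear forms the grouping disappears.\<close>

lemma quadratic_form_block_diag:
  fixes A B C D :: "nat \<Rightarrow> real mat"
  assumes A: "\<And>i. i < N \<Longrightarrow> A i \<in> carrier_mat (a i) (a i)"
    and B: "\<And>i. i < N \<Longrightarrow> B i \<in> carrier_mat (a i) (b i)"
    and C: "\<And>i. i < N \<Longrightarrow> C i \<in> carrier_mat (b i) (a i)"
    and D: "\<And>i. i < N \<Longrightarrow> D i \<in> carrier_mat (b i) (b i)"
    and v: "\<And>i. i < N \<Longrightarrow> v i \<in> carrier_vec (a i)"
    and w: "\<And>i. i < N \<Longrightarrow> w i \<in> carrier_vec (b i)"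
  defines "z \<equiv> concat_vecs N v @\<^sub>v concat_vecs N w"
  shows "z \<bullet> (four_block_mat (block_diag N (\<lambda>i. \<mu> i \<cdot>\<^sub>m A i)) (block_diag N (\<lambda>i. \<mu> i \<cdot>\<^sub>m B i))
      (block_diag N (\<lambda>i. \<mu> i \<cdot>\<^sub>m C i)) (block_diag N (\<lambda>i. \<mu> i \<cdot>\<^sub>m D i)) *\<^sub>v z) =
    (\<Sum>i<N. \<mu> i * ((v i @\<^sub>v w i) \<bullet> (four_block_mat (A i) (B i) (C i) (D i) *\<^sub>v (v i @\<^sub>v w i))))"
proof -
  \<comment> \<open>Rectangular blocks and two different vectors are allowed, so that the same
    identity covers the diagonal and the off-diagonal blocks.\<close>
  have bil: "concat_vecs N x \<bullet> (block_diag N (\<lambda>i. \<mu> i \<cdot>\<^sub>m E i) *\<^sub>v concat_vecs N y) =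
      (\<Sum>i<N. \<mu> i * (x i \<bullet> (E i *\<^sub>v y i)))"
    if "\<And>i. i < N \<Longrightarrow> E i \<in> carrier_mat (n i) (m i)" "\<And>i. i < N \<Longrightarrow> x i \<in> carrier_vec (n i)"
      "\<And>i. i < N \<Longrightarrow> y i \<in> carrier_vec (m i)" for E x y n m
  proof -
    have "block_diag N (\<lambda>i. \<mu> i \<cdot>\<^sub>m E i) *\<^sub>v concat_vecs N y = concat_vecs N (\<lambda>i. (\<mu> i \<cdot>\<^sub>m E i) *\<^sub>v y i)"
      using that by (intro block_diag_mult_concat_vecs[where nr = n and nc = m]) auto
    also have "concat_vecs N x \<bullet> \<dots> = (\<Sum>i<N. x i \<bullet> ((\<mu> i \<cdot>\<^sub>m E i) *\<^sub>v y i))"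
      using that by (intro scalar_prod_concat_vecs) (metis carrier_matD(1) carrier_vecD dim_mult_mat_vec index_smult_mat(2))
    also have "\<dots> = (\<Sum>i<N. \<mu> i * (x i \<bullet> (E i *\<^sub>v y i)))"
      by (intro sum.cong refl smult_quadratic_form[OF that]) auto
    finally show ?thesis .
  qed
  have car: "block_diag N (\<lambda>i. \<mu> i \<cdot>\<^sub>m A i) \<in> carrier_mat (\<Sum>i<N. a i) (\<Sum>i<N. a i)"
    "block_diag N (\<lambda>i. \<mu> i \<cdot>\<^sub>m B i) \<in> carrier_mat (\<Sum>i<N. a i) (\<Sum>i<N. b i)"
    "block_diag N (\<lambda>i. \<mu> i \<cdot>\<^sub>m C i) \<in> carrier_mat (\<Sum>i<N. b i) (\<Sum>i<N. a i)"
    "block_diag N (\<lambda>i. \<mu> i \<cdot>\<^sub>m D i) \<in> carrier_mat (\<Sum>i<N. b i) (\<Sum>i<N. b i)"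
    using A B C D by (auto intro!: block_diag_carrier)
  have vw: "concat_vecs N v \<in> carrier_vec (\<Sum>i<N. a i)" "concat_vecs N w \<in> carrier_vec (\<Sum>i<N. b i)"
    using v w by auto
  have "(\<Sum>i<N. \<mu> i * ((v i @\<^sub>v w i) \<bullet> (four_block_mat (A i) (B i) (C i) (D i) *\<^sub>v (v i @\<^sub>v w i)))) =
    (\<Sum>i<N. \<mu> i * (v i \<bullet> (A i *\<^sub>v v i) + v i \<bullet> (B i *\<^sub>v w i) + (w i \<bullet> (C i *\<^sub>v v i) + w i \<bullet> (D i *\<^sub>v w i))))"
    using assms by (intro sum.cong refl arg_cong2[where f = "(*)"] quadratic_form_four_block) auto
  moreover note bil[where n = a and m = a, of A v v] bil[where n = a and m = b, of B v w]
    bil[where n = b and m = a, of C w v] bil[where n = b and m = b, of D w w]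
  ultimately show ?thesis
    using A B C D v w unfolding z_def quadratic_form_four_block[OF car vw]
    by (simp add: sum.distrib distrib_left)
qed

section \<open>Differentiating sums over blocks of coordinates\<close>

text \<open>Selecting distinct coordinates keeps only some of the squared differences, so the map
  does not increase distances.\<close>

lemma continuous_map_euclid_select:
  assumes inj: "inj_on \<sigma> {..<k}" and range: "\<sigma> ` {..<k} \<subseteq> {..<m}"
  shows "continuous_map (euclid m) (euclid k) (\<lambda>z. vec k (\<lambda>j. z $ \<sigma> j))"
proof -
  have "euclid_dist k (vec k (\<lambda>j. a $ \<sigma> j)) (vec k (\<lambda>j. x $ \<sigma> j)) \<le> euclid_dist m a x" for a x
  proof -
    have "(\<Sum>j<k. (a $ \<sigma> j - x $ \<sigma> j)\<^sup>2) = (\<Sum>p\<in>\<sigma> ` {..<k}. (a $ p - x $ p)\<^sup>2)"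
      by (simp add: sum.reindex[OF inj])
    also have "\<dots> \<le> (\<Sum>p<m. (a $ p - x $ p)\<^sup>2)"
      using range by (intro sum_mono2) auto
    finally show ?thesis by (simp add: euclid_dist_def L2_set_def)
  qed
  then have "\<forall>a\<in>carrier_vec m. \<forall>\<epsilon>>0. \<exists>\<delta>>0. \<forall>x. x \<in> carrier_vec m \<and> euclid_dist m a x < \<delta> \<longrightarrow>
      euclid_dist k (vec k (\<lambda>j. a $ \<sigma> j)) (vec k (\<lambda>j. x $ \<sigma> j)) < \<epsilon>"
    by (meson order_le_less_trans)
  then show ?thesis
    unfolding euclid_def Metric_space.metric_continuous_map[OF Metric_space_euclid Metric_space_euclid]
    by auto
qed

text \<open>\<open>\<sigma> (i, j)\<close> is the position in the large vector of the
  \<open>j\<close>-th variable of \<open>F i\<close>. Keeping the bijection abstract separates the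
  calculus from the index arithmetic of stacked vectors.\<close>

context
  fixes \<sigma> :: "nat \<times> nat \<Rightarrow> nat" and N m :: nat and k :: "nat \<Rightarrow> nat" and c :: "nat \<Rightarrow> real"
    and F :: "nat \<Rightarrow> real vec \<Rightarrow> real" and G :: "real vec \<Rightarrow> real"
  assumes bij: "bij_betw \<sigma> (SIGMA i:{..<N}. {..<k i}) {..<m}"
    and F: "\<And>i. i < N \<Longrightarrow> cont_differentiable (k i) (F i)"
    and G: "\<And>z. z \<in> carrier_vec m \<Longrightarrow> G z = (\<Sum>i<N. c i * F i (vec (k i) (\<lambda>j. z $ \<sigma> (i, j))))"
begin

text \<open>The summands depend on disjoint groups of variables. Moving the variable at
  \<open>\<sigma> (i, j)\<close> changes summand \<open>i\<close> alone, and the others form a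
  constant.\<close>

lemma block_sum_has_partial_deriv:
  assumes z: "z \<in> carrier_vec m" and i: "i < N" and j: "j < k i"
  shows "(line_through m G (\<sigma> (i, j)) z has_field_derivative
    c i * partial_deriv (k i) (F i) j (vec (k i) (\<lambda>j. z $ \<sigma> (i, j)))) (at 0)"
proof -
  define P where "P l z = vec (k l) (\<lambda>j. z $ \<sigma> (l, j))" for l and z :: "real vec"
  let ?R = "\<Sum>l\<in>{..<N} - {i}. c l * F l (P l z)"
  have lt: "\<sigma> (l, q) < m" if "l < N" "q < k l" for l q
    using bij that by (auto simp: bij_betw_def)
  have eq_iff: "\<sigma> (l, q) = \<sigma> (i, j) \<longleftrightarrow> l = i \<and> q = j" if "l < N" "q < k l" for l q
    using inj_on_eq_iff[OF bij_betw_imp_inj_on[OF bij], of "(l, q)" "(i, j)"] that i j by auto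
  have "line_through m G (\<sigma> (i, j)) z = (\<lambda>t. c i * line_through (k i) (F i) j (P i z) t + ?R)"
  proof
    fix t
    let ?z = "z + t \<cdot>\<^sub>v unit_vec m (\<sigma> (i, j))"
    have same: "P i ?z = P i z + t \<cdot>\<^sub>v unit_vec (k i) j"
      using z lt i j eq_iff by (auto simp: P_def unit_vec_def intro!: eq_vecI)
    have other: "P l ?z = P l z" if "l \<in> {..<N} - {i}" for l
      using z lt i j eq_iff that by (auto simp: P_def unit_vec_def intro!: eq_vecI)
    have "line_through m G (\<sigma> (i, j)) z t = (\<Sum>l<N. c l * F l (P l ?z))"
      using z by (simp add: line_through_def G P_def)
    also have "\<dots> = c i * F i (P i ?z) + (\<Sum>l\<in>{..<N} - {i}. c l * F l (P l ?z))"
      using i by (intro sum.remove) auto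
    also have "(\<Sum>l\<in>{..<N} - {i}. c l * F l (P l ?z)) = ?R"
      using other by (intro sum.cong) auto
    finally show "line_through m G (\<sigma> (i, j)) z t = c i * line_through (k i) (F i) j (P i z) t + ?R"
      by (simp add: line_through_def same)
  qed
  \<comment> \<open>Differentiability of the line function at 0 guarantees that \<open>deriv\<close>
    in \<open>partial_deriv\<close> denotes an actual derivative.\<close>
  moreover have "(line_through (k i) (F i) j (P i z) has_field_derivative
      partial_deriv (k i) (F i) j (P i z)) (at 0)"
    using F[OF i] j unfolding cont_differentiable_def partial_deriv_def DERIV_deriv_iff_field_differentiable
    by (simp add: P_def)
  ultimately show ?thesis
    by (auto simp: P_def[symmetric] intro!: derivative_eq_intros)
qed

lemma block_sum_partial_deriv:
  assumes "z \<in> carrier_vec m" "i < N" "j < k i"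
  shows "partial_deriv m G (\<sigma> (i, j)) z =
    c i * partial_deriv (k i) (F i) j (vec (k i) (\<lambda>j. z $ \<sigma> (i, j)))"
  using DERIV_imp_deriv[OF block_sum_has_partial_deriv[OF assms]] by (simp add: partial_deriv_def)

text \<open>As \<open>\<sigma>\<close> is onto, each variable belongs to some summand; the partial
  derivative of \<open>G\<close> is then a multiple of one of \<open>F i\<close>, composed with a
  continuous selection of coordinates.\<close>

lemma cont_differentiable_block_sum:
  shows "cont_differentiable m G"
  unfolding cont_differentiable_def
proof (intro allI impI conjI ballI)
  fix p assume "p < m"
  then have "p \<in> \<sigma> ` (SIGMA i:{..<N}. {..<k i})"
    using bij_betw_imp_surj_on[OF bij] by simp
  then obtain i j where ij: "i < N" "j < k i" and p: "p = \<sigma> (i, j)"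
    by auto
  show "line_through m G p z field_differentiable at 0" if "z \<in> carrier_vec m" for z
    using block_sum_has_partial_deriv[OF that ij] p
    by (auto simp: field_differentiable_def)
  let ?P = "\<lambda>z. vec (k i) (\<lambda>j. z $ \<sigma> (i, j)) :: real vec"
  have "inj_on (\<lambda>j. \<sigma> (i, j)) {..<k i}" "(\<lambda>j. \<sigma> (i, j)) ` {..<k i} \<subseteq> {..<m}"
    using bij ij(1) by (auto simp: bij_betw_def inj_on_def)
  then have "continuous_map (euclid m) (euclid (k i)) ?P"
    by (rule continuous_map_euclid_select)
  moreover have "continuous_map (euclid (k i)) euclideanreal (partial_deriv (k i) (F i) j)"
    using F[OF ij(1)] ij(2) by (simp add: cont_differentiable_def)
  ultimately have "continuous_map (euclid m) euclideanreal (\<lambda>z. partial_deriv (k i) (F i) j (?P z))"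
    by (rule continuous_map_compose[unfolded o_def])
  then have "continuous_map (euclid m) euclideanreal (\<lambda>z. c i * partial_deriv (k i) (F i) j (?P z))"
    by (intro continuous_map_real_mult_left)
  \<comment> \<open>The formula for the partial derivative is available on
    \<open>carrier_vec m\<close>, which is the whole space of \<open>euclid m\<close>.\<close>
  then show "continuous_map (euclid m) euclideanreal (partial_deriv m G p)"
    by (rule continuous_map_eq) (simp add: p block_sum_partial_deriv[OF _ ij])
qed

text \<open>Reindexing the scalar product along \<open>\<sigma>\<close> splits it into one
  double-indexed sum per block.\<close>

lemma gradient_block_sum:
  assumes z: "z \<in> carrier_vec m" and v: "v \<in> carrier_vec m"
  shows "gradient m G z \<bullet> v = (\<Sum>i<N. c i *
    (gradient (k i) (F i) (vec (k i) (\<lambda>j. z $ \<sigma> (i, j))) \<bullet> vec (k i) (\<lambda>j. v $ \<sigma> (i, j))))"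
proof -
  have "gradient m G z \<bullet> v = (\<Sum>p<m. partial_deriv m G p z * v $ p)"
    using v by (auto simp: scalar_prod_def gradient_def lessThan_atLeast0 intro!: sum.cong)
  also have "\<dots> = (\<Sum>(i, j)\<in>(SIGMA i:{..<N}. {..<k i}). partial_deriv m G (\<sigma> (i, j)) z * v $ \<sigma> (i, j))"
    by (subst sum.reindex_bij_betw[OF bij, symmetric]) (simp add: case_prod_beta)
  also have "\<dots> = (\<Sum>i<N. \<Sum>j<k i. partial_deriv m G (\<sigma> (i, j)) z * v $ \<sigma> (i, j))"
    by (subst sum.Sigma) auto
  also have "\<dots> = (\<Sum>i<N. c i *
    (gradient (k i) (F i) (vec (k i) (\<lambda>j. z $ \<sigma> (i, j))) \<bullet> vec (k i) (\<lambda>j. v $ \<sigma> (i, j))))"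
    using block_sum_partial_deriv[OF z]
    by (auto simp: scalar_prod_def gradient_def lessThan_atLeast0 sum_distrib_left mult.assoc intro!: sum.cong)
  finally show ?thesis .
qed

end

text \<open>
  Position, in the stacked vector \<open>[x\<^sub>1; \<dots>; x\<^sub>N; xh\<^sub>1; \<dots>; xh\<^sub>N]\<close>, of the \<open>j\<close>-th coordinate of
  \<open>[x\<^sub>i; xh\<^sub>i]\<close>.
\<close>

definition pair_index :: "nat \<Rightarrow> (nat \<Rightarrow> nat) \<Rightarrow> (nat \<Rightarrow> nat) \<Rightarrow> nat \<times> nat \<Rightarrow> nat" where
  "pair_index N n nh = (\<lambda>(i, j). if j < n i then (\<Sum>l<i. n l) + j
     else (\<Sum>l<N. n l) + ((\<Sum>l<i. nh l) + (j - n i)))"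

text \<open>Each half of the stacked vector is tiled by its own blocks, so
  \<open>block_offset_bij\<close> is applied once to the dimensions \<open>n\<close> and once to
  \<open>nh\<close>.\<close>

lemma pair_index_bij:
  "bij_betw (pair_index N n nh) (SIGMA i:{..<N}. {..<n i + nh i}) {..<(\<Sum>l<N. n l) + (\<Sum>l<N. nh l)}"
proof (rule bij_betw_imageI)
  note B = block_offset_bij[of n N] block_offset_bij[of nh N]
  have inj: "i = i' \<and> j = j'"
    if "bij_betw (\<lambda>(i, j). (\<Sum>l<i. d l) + j) (SIGMA i:{..<N}. {..<d i}) {..<\<Sum>l<N. d l}"
      "(\<Sum>l<i. d l) + j = (\<Sum>l<i'. d l) + j'" "i < N" "i' < N" "j < d i" "j' < d i'" for d :: "nat \<Rightarrow> nat" and i i' j j'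
    using inj_onD[OF bij_betw_imp_inj_on[OF that(1)], of "(i, j)" "(i', j')"] that by simp
  show "inj_on (pair_index N n nh) (SIGMA i:{..<N}. {..<n i + nh i})"
  proof (rule inj_onI, clarify)
    fix i j i' j'
    assume ij: "i < N" "j < n i + nh i" "i' < N" "j' < n i' + nh i'"
      and eq: "pair_index N n nh (i, j) = pair_index N n nh (i', j')"
    \<comment> \<open>The states without hat fill the positions below the sum of all
      \<open>n l\<close> and the hatted ones the rest, so equal positions lie in the same
      half.\<close>
    have iff: "j < n i \<longleftrightarrow> j' < n i'"
      using eq ij block_offset_less[of i N j n] block_offset_less[of i' N j' n]
      by (auto simp: pair_index_def split: if_splits)
    show "i = i' \<and> j = j'"
    proof (cases "j < n i")
      case True
      then show ?thesis
        using eq ij iff inj[OF B(1), of i j i' j'] by (simp add: pair_index_def)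
    next
      case False
      \<comment> \<open>Writing the index as \<open>n i + l\<close> removes the truncated
        subtraction in \<open>pair_index\<close>.\<close>
      then obtain l l' where "j = n i + l" "j' = n i' + l'"
        using iff by (metis le_Suc_ex not_less)
      then show ?thesis
        using eq ij inj[OF B(2), of i l i' l'] by (auto simp: pair_index_def)
    qed
  qed
  have "p \<in> pair_index N n nh ` (SIGMA i:{..<N}. {..<n i + nh i})"
    if p: "p < (\<Sum>l<N. n l) + (\<Sum>l<N. nh l)" for p
  proof (cases "p < (\<Sum>l<N. n l)")
    case True
    then have "p \<in> (\<lambda>(i, j). (\<Sum>l<i. n l) + j) ` (SIGMA i:{..<N}. {..<n i})"
      using B(1) by (simp add: bij_betw_def)
    then obtain i j where "i < N" "j < n i" "p = (\<Sum>l<i. n l) + j" by auto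
    then show ?thesis by (intro image_eqI[of _ _ "(i, j)"]) (auto simp: pair_index_def)
  next
    case False
    then have "p - (\<Sum>l<N. n l) \<in> (\<lambda>(i, j). (\<Sum>l<i. nh l) + j) ` (SIGMA i:{..<N}. {..<nh i})"
      using B(2) p by (simp add: bij_betw_def less_diff_conv2)
    then obtain i j where "i < N" "j < nh i" "p - (\<Sum>l<N. n l) = (\<Sum>l<i. nh l) + j" by auto
    then show ?thesis using False
      \<comment> \<open>Within the pair of block \<open>i\<close> the hatted coordinates start after
        the first \<open>n i\<close> ones.\<close>
      by (intro image_eqI[of _ _ "(i, n i + j)"]) (auto simp: pair_index_def)
  qed
  moreover have "pair_index N n nh (i, j) < (\<Sum>l<N. n l) + (\<Sum>l<N. nh l)"
    if "i < N" "j < n i + nh i" for i j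
  proof (cases "j < n i")
    case True
    then show ?thesis using that block_offset_less[of i N j n] by (simp add: pair_index_def)
  next
    case False
    then obtain l where "j = n i + l" by (metis le_Suc_ex not_less)
    then show ?thesis using that block_offset_less[of i N l nh] by (simp add: pair_index_def)
  qed
  ultimately show "pair_index N n nh ` (SIGMA i:{..<N}. {..<n i + nh i}) =
      {..<(\<Sum>l<N. n l) + (\<Sum>l<N. nh l)}"
    by auto
qed

lemma vec_first_append: "a \<in> carrier_vec n \<Longrightarrow> vec_first (a @\<^sub>v b) n = a"
  by (auto simp: vec_first_def intro!: eq_vecI)

lemma vec_last_append: "b \<in> carrier_vec n \<Longrightarrow> vec_last (a @\<^sub>v b) n = b"
  by (auto simp: vec_last_def intro!: eq_vecI)

text \<open>Links the abstract selection of coordinates to the argument of the \<open>i\<close>-th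
  storage function.\<close>

lemma select_pair_index:
  assumes "a \<in> carrier_vec (\<Sum>l<N. n l)" "b \<in> carrier_vec (\<Sum>l<N. nh l)" "i < N"
  shows "vec (n i + nh i) (\<lambda>j. (a @\<^sub>v b) $ pair_index N n nh (i, j)) = vec_block n i a @\<^sub>v vec_block nh i b"
proof (rule eq_vecI)
  fix j assume "j < dim_vec (vec_block n i a @\<^sub>v vec_block nh i b)"
  then have j: "j < n i + nh i" by (simp add: vec_block_def)
  show "vec (n i + nh i) (\<lambda>j. (a @\<^sub>v b) $ pair_index N n nh (i, j)) $ j = (vec_block n i a @\<^sub>v vec_block nh i b) $ j"
  proof (cases "j < n i")
    case True
    then show ?thesis
      using assms j block_offset_less[of i N j n] by (simp add: pair_index_def vec_block_def)
  next
    case False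
    then obtain l where "j = n i + l" by (metis le_Suc_ex not_less)
    then show ?thesis
      using assms j block_offset_less[of i N l nh] by (simp add: pair_index_def vec_block_def)
  qed
qed (simp add: vec_block_def)

context
  fixes N :: nat and n nh :: "nat \<Rightarrow> nat" and V :: "nat \<Rightarrow> real vec \<Rightarrow> real vec \<Rightarrow> real" and c :: "nat \<Rightarrow> real"
  assumes V: "\<And>i. i < N \<Longrightarrow> cont_differentiable (n i + nh i) (on_concat (n i) (nh i) (V i))"
begin

text \<open>Splitting \<open>z\<close> into its two halves exhibits the weighted sum as an instance
  of the function \<open>G\<close> of the abstract setting.\<close>

private lemma on_concat_block_sum:
  assumes z: "z \<in> carrier_vec ((\<Sum>i<N. n i) + (\<Sum>i<N. nh i))"
  shows "on_concat (\<Sum>i<N. n i) (\<Sum>i<N. nh i) (\<lambda>x xh. \<Sum>i<N. c i * V i (vec_block n i x) (vec_block nh i xh)) z =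
    (\<Sum>i<N. c i * on_concat (n i) (nh i) (V i) (vec (n i + nh i) (\<lambda>j. z $ pair_index N n nh (i, j))))"
proof -
  let ?a = "vec_first z (\<Sum>i<N. n i)" and ?b = "vec_last z (\<Sum>i<N. nh i)"
  have "vec (n i + nh i) (\<lambda>j. z $ pair_index N n nh (i, j)) = vec_block n i ?a @\<^sub>v vec_block nh i ?b"
    if "i < N" for i
    using select_pair_index[of ?a n N ?b nh i] that by (simp add: vec_first_last_append[OF z])
  then show ?thesis
    by (simp add: on_concat_def vec_first_append vec_last_append)
qed

lemma cont_differentiable_on_concat_sum:
  "cont_differentiable ((\<Sum>i<N. n i) + (\<Sum>i<N. nh i)) (on_concat (\<Sum>i<N. n i) (\<Sum>i<N. nh i)
     (\<lambda>x xh. \<Sum>i<N. c i * V i (vec_block n i x) (vec_block nh i xh)))"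
  by (rule cont_differentiable_block_sum[where F = "\<lambda>i. on_concat (n i) (nh i) (V i)"])
    (rule pair_index_bij V on_concat_block_sum | assumption)+

text \<open>The interconnection stacks all vector fields before all hatted ones, while the subsystem
  inequalities use one pair at a time; this regrouping lets them be summed.\<close>

lemma gradient_on_concat_sum:
  assumes x: "x \<in> carrier_vec (\<Sum>i<N. n i)" and xh: "xh \<in> carrier_vec (\<Sum>i<N. nh i)"
    and y: "\<And>i. i < N \<Longrightarrow> y i \<in> carrier_vec (n i)" and yh: "\<And>i. i < N \<Longrightarrow> yh i \<in> carrier_vec (nh i)"
  shows "gradient ((\<Sum>i<N. n i) + (\<Sum>i<N. nh i)) (on_concat (\<Sum>i<N. n i) (\<Sum>i<N. nh i)
      (\<lambda>x xh. \<Sum>i<N. c i * V i (vec_block n i x) (vec_block nh i xh))) (x @\<^sub>v xh) \<bullet>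
      (concat_vecs N y @\<^sub>v concat_vecs N yh) =
    (\<Sum>i<N. c i * (gradient (n i + nh i) (on_concat (n i) (nh i) (V i))
      (vec_block n i x @\<^sub>v vec_block nh i xh) \<bullet> (y i @\<^sub>v yh i)))"
proof -
  have Y: "concat_vecs N y \<in> carrier_vec (\<Sum>i<N. n i)" "concat_vecs N yh \<in> carrier_vec (\<Sum>i<N. nh i)"
    using y yh by auto
  let ?G = "on_concat (\<Sum>i<N. n i) (\<Sum>i<N. nh i)
      (\<lambda>x xh. \<Sum>i<N. c i * V i (vec_block n i x) (vec_block nh i xh))"
  let ?k = "\<lambda>i. n i + nh i" and ?F = "\<lambda>i. on_concat (n i) (nh i) (V i)"
  have "gradient ((\<Sum>i<N. n i) + (\<Sum>i<N. nh i)) ?G (x @\<^sub>v xh) \<bullet> (concat_vecs N y @\<^sub>v concat_vecs N yh) =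
    (\<Sum>i<N. c i * (gradient (?k i) (?F i) (vec (?k i) (\<lambda>j. (x @\<^sub>v xh) $ pair_index N n nh (i, j))) \<bullet>
      vec (?k i) (\<lambda>j. (concat_vecs N y @\<^sub>v concat_vecs N yh) $ pair_index N n nh (i, j))))"
    by (rule gradient_block_sum)
      (rule pair_index_bij V on_concat_block_sum append_carrier_vec x xh Y | assumption)+
  also have "\<dots> = (\<Sum>i<N. c i * (gradient (?k i) (?F i) (vec_block n i x @\<^sub>v vec_block nh i xh) \<bullet> (y i @\<^sub>v yh i)))"
  proof (intro sum.cong refl)
    fix i assume "i \<in> {..<N}"
    then have i: "i < N" by simp
    have "vec_block n i (concat_vecs N y) = y i" "vec_block nh i (concat_vecs N yh) = yh i"
      using vec_block_concat_vecs i y yh by blast+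
    then show "c i * (gradient (?k i) (?F i) (vec (?k i) (\<lambda>j. (x @\<^sub>v xh) $ pair_index N n nh (i, j))) \<bullet>
        vec (?k i) (\<lambda>j. (concat_vecs N y @\<^sub>v concat_vecs N yh) $ pair_index N n nh (i, j))) =
      c i * (gradient (?k i) (?F i) (vec_block n i x @\<^sub>v vec_block nh i xh) \<bullet> (y i @\<^sub>v yh i))"
      by (simp only: select_pair_index[OF x xh i] select_pair_index[OF Y i])
  qed
  finally show ?thesis .
qed

end

section \<open>Compositionality\<close>

theorem theorem4p2:
  fixes N :: nat
    and S Sh :: "nat \<Rightarrow> system"
    and V :: "nat \<Rightarrow> real vec \<Rightarrow> real vec \<Rightarrow> real"
    and \<alpha> \<eta> \<rho> :: "nat \<Rightarrow> real \<Rightarrow> real"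
    and r :: "nat \<Rightarrow> nat"
    and W Wh H X11 X12 X21 X22 :: "nat \<Rightarrow> real mat"
    and M Mh :: "real mat"
    and \<mu> :: "nat \<Rightarrow> real"
  defines "qt \<equiv> \<Sum>i<N. q2_of (S i)"
    and "X \<equiv> four_block_mat
               (block_diag N (\<lambda>i. \<mu> i \<cdot>\<^sub>m X11 i)) (block_diag N (\<lambda>i. \<mu> i \<cdot>\<^sub>m X12 i))
               (block_diag N (\<lambda>i. \<mu> i \<cdot>\<^sub>m X21 i)) (block_diag N (\<lambda>i. \<mu> i \<cdot>\<^sub>m X22 i))"
    and "WM \<equiv> block_diag N W * M"
  assumes "N \<ge> 1"
    and "\<And>i. i < N \<Longrightarrow> control_system (S i)"
    and "\<And>i. i < N \<Longrightarrow> control_system (Sh i)"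
    and "\<And>i. i < N \<Longrightarrow> storage_function_with (Sh i) (S i) (V i) (\<alpha> i) (\<eta> i) (\<rho> i)
           (r i) (W i) (Wh i) (H i) (X11 i) (X12 i) (X21 i) (X22 i)"
    and "M \<in> carrier_mat (\<Sum>i<N. p_of (S i)) (\<Sum>i<N. q2_of (S i))"
    and "Mh \<in> carrier_mat (\<Sum>i<N. p_of (Sh i)) (\<Sum>i<N. q2_of (Sh i))"
    and "\<And>i. i < N \<Longrightarrow> \<mu> i > 0"
    and "neg_semidef qt ((WM @\<^sub>r 1\<^sub>m qt)\<^sup>T * X * (WM @\<^sub>r 1\<^sub>m qt))"
    and "WM * block_diag N H = block_diag N Wh * Mh"
  shows "simulation_function (interconnection N Sh Mh) (interconnection N S M)
           (\<lambda>x xh. \<Sum>i<N. \<mu> i * V i (vec_block (\<lambda>j. n_of (S j)) i x)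
                                      (vec_block (\<lambda>j. n_of (Sh j)) i xh))"
proof -

  \<comment> \<open>Dimensions and data of the subsystems\<close>
  let ?n = "\<lambda>i. n_of (S i)" and ?nh = "\<lambda>i. n_of (Sh i)"
  let ?m = "\<lambda>i. m_of (S i)" and ?mh = "\<lambda>i. m_of (Sh i)"
  let ?p = "\<lambda>i. p_of (S i)" and ?ph = "\<lambda>i. p_of (Sh i)"
  let ?q = "\<lambda>i. q2_of (S i)" and ?qh = "\<lambda>i. q2_of (Sh i)"
  let ?V = "\<lambda>x xh. \<Sum>i<N. \<mu> i * V i (vec_block ?n i x) (vec_block ?nh i xh)"
  have xc: "vec_block ?n i x \<in> carrier_vec (?n i)" and xhc: "vec_block ?nh i x \<in> carrier_vec (?nh i)"
    and uhc: "vec_block ?mh i x \<in> carrier_vec (?mh i)"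
    and wc: "vec_block ?p i x \<in> carrier_vec (?p i)" and whc: "vec_block ?ph i x \<in> carrier_vec (?ph i)" for i x
    by (rule vec_block_carrier)+
  note \<mu> = assms(10) and sf = assms(7)[unfolded storage_function_with_def]
  have h1: "h1_of T x \<in> carrier_vec (q1_of T)" and h2: "h2_of T x \<in> carrier_vec (q2_of T)"
    if "control_system T" "x \<in> carrier_vec (n_of T)" for T x
    using that by (auto simp: control_system_def)
  have f: "f_of T x u w \<in> carrier_vec (n_of T)"
    if T: "control_system T" and xuw: "x \<in> carrier_vec (n_of T)" "u \<in> carrier_vec (m_of T)" "w \<in> carrier_vec (p_of T)"
    for T x u w
  proof -
    \<comment> \<open>The dimension of the values of \<open>f_of\<close> is contained in its
      continuity as a map into \<open>euclid (n_of T)\<close>.\<close>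
    have "continuous_map
       (prod_topology (euclid (n_of T)) (prod_topology (euclid (m_of T)) (euclid (p_of T))))
       (euclid (n_of T)) (\<lambda>(x, u, w). f_of T x u w)"
      using T by (simp add: control_system_def)
    from continuous_map_image_subset_topspace[OF this] show ?thesis
      using xuw by (auto simp: image_subset_iff)
  qed
  have q1: "q1_of (Sh i) = q1_of (S i)"
    and V_nonneg: "\<And>x xh. x \<in> carrier_vec (?n i) \<Longrightarrow> xh \<in> carrier_vec (?nh i) \<Longrightarrow> 0 \<le> V i x xh"
    and V_diff: "cont_differentiable (?n i + ?nh i) (on_concat (?n i) (?nh i) (V i))"
    and \<alpha>: "class_Kinf (\<alpha> i)" and \<eta>: "class_Kinf (\<eta> i)" and \<rho>: "class_Kinf_or_zero (\<rho> i)"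
    and W: "W i \<in> carrier_mat (r i) (?p i)" and Wh: "Wh i \<in> carrier_mat (r i) (?ph i)"
    and H: "H i \<in> carrier_mat (?q i) (?qh i)"
    and X11: "X11 i \<in> carrier_mat (r i) (r i)" and X12: "X12 i \<in> carrier_mat (r i) (?q i)"
    and X21: "X21 i \<in> carrier_mat (?q i) (r i)" and X22: "X22 i \<in> carrier_mat (?q i) (?q i)"
    and V_lower: "\<And>x xh. x \<in> carrier_vec (?n i) \<Longrightarrow> xh \<in> carrier_vec (?nh i) \<Longrightarrow>
      \<alpha> i (vnorm (h1_of (S i) x - h1_of (Sh i) xh)) \<le> V i x xh"
    if "i < N" for i
    using sf[OF that] by auto
  have decay: "\<exists>u\<in>carrier_vec (?m i). \<forall>wh\<in>carrier_vec (?ph i). \<forall>w\<in>carrier_vec (?p i).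
      gradient (?n i + ?nh i) (on_concat (?n i) (?nh i) (V i)) (x @\<^sub>v xh) \<bullet>
        (f_of (S i) x u w @\<^sub>v f_of (Sh i) xh uh wh)
      \<le> - \<eta> i (V i x xh) + \<rho> i (vnorm uh) +
        (let z = (W i *\<^sub>v w - Wh i *\<^sub>v wh) @\<^sub>v (h2_of (S i) x - H i *\<^sub>v h2_of (Sh i) xh)
         in z \<bullet> (four_block_mat (X11 i) (X12 i) (X21 i) (X22 i) *\<^sub>v z))"
    if "i < N" "x \<in> carrier_vec (?n i)" "xh \<in> carrier_vec (?nh i)" "uh \<in> carrier_vec (?mh i)" for i x xh uh
    using sf[OF that(1)] that(2-4) by blast

  \<comment> \<open>Comparison functions for the weighted sum\<close>
  have "class_Kinf (\<lambda>s. \<mu> i * \<alpha> i s)" if "i < N" for i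
    using class_Kinf_scale[OF \<alpha>[OF that] \<mu>[OF that], of 1] by simp
  then have "\<exists>\<alpha>'. class_Kinf \<alpha>' \<and>
      (\<forall>a. (\<forall>i<N. 0 \<le> a i) \<longrightarrow> \<alpha>' (\<Sum>i<N. a i) \<le> (\<Sum>i<N. \<mu> i * \<alpha> i (a i)))"
    by (rule class_Kinf_le_sum[OF assms(4)])
  then obtain \<alpha>' where \<alpha>': "class_Kinf \<alpha>'"
    and \<alpha>'_le: "\<And>a. \<forall>i<N. 0 \<le> a i \<Longrightarrow> \<alpha>' (\<Sum>i<N. a i) \<le> (\<Sum>i<N. \<mu> i * \<alpha> i (a i))"
    by blast
  \<comment> \<open>The terms to be summed are \<open>\<mu> i * V i\<close>, whereas
    \<open>\<eta> i\<close> acts on \<open>V i\<close>; hence the division by the positive weight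
    inside.\<close>
  have "class_Kinf (\<lambda>s. \<mu> i * \<eta> i ((1 / \<mu> i) * s))" if "i < N" for i
    using class_Kinf_scale[OF \<eta>[OF that] \<mu>[OF that], of "1 / \<mu> i"] \<mu>[OF that] by simp
  then have "\<exists>\<eta>'. class_Kinf \<eta>' \<and>
      (\<forall>a. (\<forall>i<N. 0 \<le> a i) \<longrightarrow> \<eta>' (\<Sum>i<N. a i) \<le> (\<Sum>i<N. \<mu> i * \<eta> i ((1 / \<mu> i) * a i)))"
    by (rule class_Kinf_le_sum[OF assms(4)])
  then obtain \<eta>' where \<eta>': "class_Kinf \<eta>'"
    and \<eta>'_le: "\<And>a. \<forall>i<N. 0 \<le> a i \<Longrightarrow> \<eta>' (\<Sum>i<N. a i) \<le> (\<Sum>i<N. \<mu> i * \<eta> i ((1 / \<mu> i) * a i))"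
    by blast
  define \<rho>' where "\<rho>' s = (\<Sum>i<N. \<mu> i * \<rho> i s)" for s
  have \<rho>': "class_Kinf_or_zero \<rho>'"
    unfolding \<rho>'_def using \<rho> \<mu> by (intro class_Kinf_or_zero_sum class_Kinf_or_zero_scale)

  \<comment> \<open>Lower bound by the output mismatch\<close>
  have lower: "\<alpha>' (vnorm (concat_vecs N (\<lambda>i. h1_of (S i) (vec_block ?n i x)) -
      concat_vecs N (\<lambda>i. h1_of (Sh i) (vec_block ?nh i xh)))) \<le> ?V x xh" for x xh
  proof -
    let ?d = "\<lambda>i. h1_of (S i) (vec_block ?n i x) - h1_of (Sh i) (vec_block ?nh i xh)"
    have "dim_vec (h1_of (S i) (vec_block ?n i x)) = dim_vec (h1_of (Sh i) (vec_block ?nh i xh))" if "i < N" for i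
      using h1[OF assms(5)[OF that] xc] h1[OF assms(6)[OF that] xhc] q1[OF that]
      by (metis carrier_vecD)
    then have "vnorm (concat_vecs N (\<lambda>i. h1_of (S i) (vec_block ?n i x)) -
        concat_vecs N (\<lambda>i. h1_of (Sh i) (vec_block ?nh i xh))) = vnorm (concat_vecs N ?d)"
      by (simp add: concat_vecs_minus)
    also have "\<alpha>' \<dots> \<le> \<alpha>' (\<Sum>i<N. vnorm (?d i))"
      by (intro class_Kinf_mono[OF \<alpha>'] vnorm_concat_vecs_le) simp
    also have "\<dots> \<le> (\<Sum>i<N. \<mu> i * \<alpha> i (vnorm (?d i)))"
      by (rule \<alpha>'_le) simp
    also have "\<dots> \<le> ?V x xh"
      using V_lower[OF _ xc xhc] \<mu> by (intro sum_mono mult_left_mono) (auto simp: less_imp_le)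
    finally show ?thesis .
  qed

  \<comment> \<open>Nonpositivity of the coupled supply rates\<close>
  have dissipative: "(\<Sum>i<N. \<mu> i * (z i \<bullet> (four_block_mat (X11 i) (X12 i) (X21 i) (X22 i) *\<^sub>v z i))) \<le> 0"
    if y: "\<And>i. i < N \<Longrightarrow> y i \<in> carrier_vec (?q i)" and yh: "\<And>i. i < N \<Longrightarrow> yh i \<in> carrier_vec (?qh i)"
      and z: "\<And>i. z i = (W i *\<^sub>v vec_block ?p i (M *\<^sub>v concat_vecs N y) -
          Wh i *\<^sub>v vec_block ?ph i (Mh *\<^sub>v concat_vecs N yh)) @\<^sub>v (y i - H i *\<^sub>v yh i)"
    for y yh z
  proof -
    let ?y = "concat_vecs N y" and ?yh = "concat_vecs N yh"
    let ?w = "\<lambda>i. vec_block ?p i (M *\<^sub>v ?y)" and ?wh = "\<lambda>i. vec_block ?ph i (Mh *\<^sub>v ?yh)"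
    let ?W = "block_diag N W" and ?Wh = "block_diag N Wh" and ?H = "block_diag N H"
    \<comment> \<open>With \<open>y\<close> and \<open>yh\<close> as the internal outputs of the two
      interconnections, \<open>?e\<close> is the stacked mismatch; it is the only vector at which
      the matrix inequality is evaluated.\<close>
    let ?e = "?y - ?H *\<^sub>v ?yh"
    have yc: "?y \<in> carrier_vec qt" and yhc: "?yh \<in> carrier_vec (\<Sum>i<N. ?qh i)"
      unfolding qt_def using y yh by auto
    have Wc: "?W \<in> carrier_mat (\<Sum>i<N. r i) (\<Sum>i<N. ?p i)"
      and Whc: "?Wh \<in> carrier_mat (\<Sum>i<N. r i) (\<Sum>i<N. ?ph i)"
      and Hc: "?H \<in> carrier_mat qt (\<Sum>i<N. ?qh i)"
      unfolding qt_def using W Wh H by (auto intro!: block_diag_carrier)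
    have Mc: "M \<in> carrier_mat (\<Sum>i<N. ?p i) qt" using assms(8) by (simp add: qt_def)
    have WMc: "WM \<in> carrier_mat (\<Sum>i<N. r i) qt" using Wc Mc by (simp add: WM_def)
    have ec: "?e \<in> carrier_vec qt" using yc Hc yhc by simp
    have Wwc: "W i *\<^sub>v ?w i \<in> carrier_vec (r i)" and Whwc: "Wh i *\<^sub>v ?wh i \<in> carrier_vec (r i)"
      and Hyc: "H i *\<^sub>v yh i \<in> carrier_vec (?q i)" if "i < N" for i
      using mult_mat_vec_carrier[OF W[OF that] wc] mult_mat_vec_carrier[OF Wh[OF that] whc]
        mult_mat_vec_carrier[OF H[OF that] yh[OF that]] by auto
    have Hyh: "?H *\<^sub>v ?yh = concat_vecs N (\<lambda>i. H i *\<^sub>v yh i)"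
      by (intro block_diag_mult_concat_vecs[where nr = ?q and nc = ?qh] H yh)
    have e: "?e = concat_vecs N (\<lambda>i. y i - H i *\<^sub>v yh i)"
      unfolding Hyh using y H by (intro concat_vecs_minus) (metis carrier_matD(1) carrier_vecD dim_mult_mat_vec)
    have "?W *\<^sub>v concat_vecs N ?w = concat_vecs N (\<lambda>i. W i *\<^sub>v ?w i)"
      by (intro block_diag_mult_concat_vecs[where nr = r and nc = ?p] W wc)
    \<comment> \<open>Restacking the blocks cut from the coupled signal recovers it.\<close>
    moreover have "concat_vecs N ?w = M *\<^sub>v ?y"
      using Mc yc by (intro concat_vecs_vec_block) auto
    ultimately have w: "concat_vecs N (\<lambda>i. W i *\<^sub>v ?w i) = WM *\<^sub>v ?y"
      using Wc Mc yc by (simp add: WM_def)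
    have "?Wh *\<^sub>v concat_vecs N ?wh = concat_vecs N (\<lambda>i. Wh i *\<^sub>v ?wh i)"
      by (intro block_diag_mult_concat_vecs[where nr = r and nc = ?ph] Wh whc)
    moreover have "concat_vecs N ?wh = Mh *\<^sub>v ?yh"
      using assms(9) yhc by (intro concat_vecs_vec_block) auto
    ultimately have "concat_vecs N (\<lambda>i. Wh i *\<^sub>v ?wh i) = (?Wh * Mh) *\<^sub>v ?yh"
      using Whc assms(9) yhc by simp
    \<comment> \<open>The matching condition on \<open>Mh\<close> enters here: it expresses the
      hatted internal inputs through the same matrix \<open>WM\<close>, so that the difference below
      becomes \<open>WM\<close> applied to the mismatch.\<close>
    also have "\<dots> = WM *\<^sub>v (?H *\<^sub>v ?yh)"
      using WMc Hc yhc unfolding assms(12)[symmetric] by (rule assoc_mult_mat_vec)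
    finally have wh: "concat_vecs N (\<lambda>i. Wh i *\<^sub>v ?wh i) = WM *\<^sub>v (?H *\<^sub>v ?yh)" .
    have "concat_vecs N (\<lambda>i. W i *\<^sub>v ?w i - Wh i *\<^sub>v ?wh i) =
        concat_vecs N (\<lambda>i. W i *\<^sub>v ?w i) - concat_vecs N (\<lambda>i. Wh i *\<^sub>v ?wh i)"
      using W Wh by (intro concat_vecs_minus[symmetric]) (metis carrier_matD(1) dim_mult_mat_vec)
    also have "\<dots> = WM *\<^sub>v ?e"
      unfolding w wh using WMc yc Hc yhc by (intro mult_minus_distrib_mat_vec[symmetric]) auto
    finally have we: "concat_vecs N (\<lambda>i. W i *\<^sub>v ?w i - Wh i *\<^sub>v ?wh i) = WM *\<^sub>v ?e" .
    let ?B = "WM @\<^sub>r 1\<^sub>m qt"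
    have Bc: "?B \<in> carrier_mat ((\<Sum>i<N. r i) + qt) qt" using WMc by simp
    have Be: "?B *\<^sub>v ?e = concat_vecs N (\<lambda>i. W i *\<^sub>v ?w i - Wh i *\<^sub>v ?wh i) @\<^sub>v
        concat_vecs N (\<lambda>i. y i - H i *\<^sub>v yh i)"
      using mat_mult_append[OF WMc one_carrier_mat ec] ec we e by simp
    have Xc: "X \<in> carrier_mat ((\<Sum>i<N. r i) + qt) ((\<Sum>i<N. r i) + qt)"
      unfolding X_def qt_def using X11 X22 by (intro four_block_carrier_mat block_diag_carrier smult_carrier_mat)
    have "(\<Sum>i<N. \<mu> i * (z i \<bullet> (four_block_mat (X11 i) (X12 i) (X21 i) (X22 i) *\<^sub>v z i))) =
        (?B *\<^sub>v ?e) \<bullet> (X *\<^sub>v (?B *\<^sub>v ?e))"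
      unfolding Be X_def z
      by (rule quadratic_form_block_diag[symmetric, where a = r and b = ?q])
        (simp_all add: X11 X12 X21 X22 Wwc Whwc Hyc y minus_carrier_vec)
    \<comment> \<open>Moving the stacked matrix across the scalar product as its transpose produces
      the matrix of the hypothesis.\<close>
    also have "\<dots> = ?e \<bullet> (?B\<^sup>T *\<^sub>v (X *\<^sub>v (?B *\<^sub>v ?e)))"
      using transpose_vec_mult_scalar[OF transpose_carrier_mat[THEN iffD2, OF Bc], of "X *\<^sub>v (?B *\<^sub>v ?e)" ?e] Bc Xc ec
      by simp
    also have "?B\<^sup>T *\<^sub>v (X *\<^sub>v (?B *\<^sub>v ?e)) = (?B\<^sup>T * X * ?B) *\<^sub>v ?e"
      using Bc Xc ec
      by (simp add: assoc_mult_mat_vec[of _ qt "(\<Sum>i<N. r i) + qt"] assoc_mult_mat_vec[of _ qt "(\<Sum>i<N. r i) + qt" _ qt])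
    also have "?e \<bullet> \<dots> \<le> 0"
      using assms(11) ec by (simp add: neg_semidef_def)
    finally show ?thesis .
  qed

  \<comment> \<open>Decay along the interconnection\<close>
  have main: "\<exists>u\<in>carrier_vec (\<Sum>i<N. ?m i).
      gradient ((\<Sum>i<N. ?n i) + (\<Sum>i<N. ?nh i)) (on_concat (\<Sum>i<N. ?n i) (\<Sum>i<N. ?nh i) ?V) (x @\<^sub>v xh) \<bullet>
        (cf_of (interconnection N S M) x u @\<^sub>v cf_of (interconnection N Sh Mh) xh uh)
      \<le> - \<eta>' (?V x xh) + \<rho>' (vnorm uh)"
    if x: "x \<in> carrier_vec (\<Sum>i<N. ?n i)" and xh: "xh \<in> carrier_vec (\<Sum>i<N. ?nh i)"
      and uh: "uh \<in> carrier_vec (\<Sum>i<N. ?mh i)" for x xh uh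
  proof -
    let ?x = "\<lambda>i. vec_block ?n i x" and ?xh = "\<lambda>i. vec_block ?nh i xh" and ?uh = "\<lambda>i. vec_block ?mh i uh"
    let ?y = "\<lambda>i. h2_of (S i) (?x i)" and ?yh = "\<lambda>i. h2_of (Sh i) (?xh i)"
    let ?w = "\<lambda>i. vec_block ?p i (M *\<^sub>v concat_vecs N ?y)"
    let ?wh = "\<lambda>i. vec_block ?ph i (Mh *\<^sub>v concat_vecs N ?yh)"
    define z where "z i = (W i *\<^sub>v ?w i - Wh i *\<^sub>v ?wh i) @\<^sub>v (?y i - H i *\<^sub>v ?yh i)" for i
    \<comment> \<open>The input of each subsystem is chosen before its internal inputs are fixed, so
      the resulting inequality can afterwards be specialised to the coupled signals
      \<open>?w i\<close> and \<open>?wh i\<close>.\<close>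
    have "\<forall>i\<in>{..<N}. \<exists>u. u \<in> carrier_vec (?m i) \<and> (\<forall>wh\<in>carrier_vec (?ph i). \<forall>w\<in>carrier_vec (?p i).
      gradient (?n i + ?nh i) (on_concat (?n i) (?nh i) (V i)) (?x i @\<^sub>v ?xh i) \<bullet>
        (f_of (S i) (?x i) u w @\<^sub>v f_of (Sh i) (?xh i) (?uh i) wh)
      \<le> - \<eta> i (V i (?x i) (?xh i)) + \<rho> i (vnorm (?uh i)) +
        (let z = (W i *\<^sub>v w - Wh i *\<^sub>v wh) @\<^sub>v (?y i - H i *\<^sub>v ?yh i)
         in z \<bullet> (four_block_mat (X11 i) (X12 i) (X21 i) (X22 i) *\<^sub>v z)))"
      using decay[OF _ xc xhc uhc] by (simp add: Bex_def)
    from bchoice[OF this] obtain u where u: "\<And>i. i < N \<Longrightarrow> u i \<in> carrier_vec (?m i)"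
      and decay_u: "\<And>i wh w. i < N \<Longrightarrow> wh \<in> carrier_vec (?ph i) \<Longrightarrow> w \<in> carrier_vec (?p i) \<Longrightarrow>
      gradient (?n i + ?nh i) (on_concat (?n i) (?nh i) (V i)) (?x i @\<^sub>v ?xh i) \<bullet>
        (f_of (S i) (?x i) (u i) w @\<^sub>v f_of (Sh i) (?xh i) (?uh i) wh)
      \<le> - \<eta> i (V i (?x i) (?xh i)) + \<rho> i (vnorm (?uh i)) +
        (let z = (W i *\<^sub>v w - Wh i *\<^sub>v wh) @\<^sub>v (?y i - H i *\<^sub>v ?yh i)
         in z \<bullet> (four_block_mat (X11 i) (X12 i) (X21 i) (X22 i) *\<^sub>v z))"
      by auto
    let ?g = "\<lambda>i. gradient (?n i + ?nh i) (on_concat (?n i) (?nh i) (V i)) (?x i @\<^sub>v ?xh i) \<bullet>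
        (f_of (S i) (?x i) (u i) (?w i) @\<^sub>v f_of (Sh i) (?xh i) (?uh i) (?wh i))"
    let ?Q = "\<lambda>i. z i \<bullet> (four_block_mat (X11 i) (X12 i) (X21 i) (X22 i) *\<^sub>v z i)"
    have "cf_of (interconnection N S M) x (concat_vecs N u) = concat_vecs N (\<lambda>i. f_of (S i) (?x i) (u i) (?w i))"
      unfolding interconnection_def using vec_block_concat_vecs[of _ N u ?m] u
      by (auto simp: Let_def intro!: concat_vecs_cong)
    moreover have "cf_of (interconnection N Sh Mh) xh uh = concat_vecs N (\<lambda>i. f_of (Sh i) (?xh i) (?uh i) (?wh i))"
      by (simp add: interconnection_def Let_def)
    ultimately have "gradient ((\<Sum>i<N. ?n i) + (\<Sum>i<N. ?nh i)) (on_concat (\<Sum>i<N. ?n i) (\<Sum>i<N. ?nh i) ?V) (x @\<^sub>v xh) \<bullet>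
        (cf_of (interconnection N S M) x (concat_vecs N u) @\<^sub>v cf_of (interconnection N Sh Mh) xh uh) =
        (\<Sum>i<N. \<mu> i * ?g i)"
      using x xh by (simp only:, intro gradient_on_concat_sum V_diff f assms(5,6) u xc xhc uhc wc whc)
    also have "\<dots> \<le> (\<Sum>i<N. \<mu> i * (- \<eta> i (V i (?x i) (?xh i)) + \<rho> i (vnorm (?uh i)) + ?Q i))"
    proof (intro sum_mono mult_left_mono)
      fix i assume "i \<in> {..<N}"
      then have i: "i < N" by simp
      show "?g i \<le> - \<eta> i (V i (?x i) (?xh i)) + \<rho> i (vnorm (?uh i)) + ?Q i"
        using decay_u[OF i whc wc] unfolding z_def Let_def .
      show "0 \<le> \<mu> i" using \<mu>[OF i] by simp
    qed
    also have "\<dots> = - (\<Sum>i<N. \<mu> i * \<eta> i (V i (?x i) (?xh i))) + (\<Sum>i<N. \<mu> i * \<rho> i (vnorm (?uh i))) + (\<Sum>i<N. \<mu> i * ?Q i)"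
      by (simp add: distrib_left right_diff_distrib sum.distrib sum_subtractf)
    also have "\<dots> \<le> - \<eta>' (?V x xh) + \<rho>' (vnorm uh) + 0"
    proof (intro add_mono le_imp_neg_le)
      \<comment> \<open>Applied with \<open>a i\<close> equal to the weighted storage value; the
        inner factor \<open>1 / \<mu> i\<close> cancels the weight.\<close>
      have "\<eta>' (?V x xh) \<le> (\<Sum>i<N. \<mu> i * \<eta> i ((1 / \<mu> i) * (\<mu> i * V i (?x i) (?xh i))))"
        using V_nonneg[OF _ xc xhc] \<mu> by (intro \<eta>'_le) (simp add: less_imp_le)
      also have "\<dots> = (\<Sum>i<N. \<mu> i * \<eta> i (V i (?x i) (?xh i)))"
        using \<mu> by (intro sum.cong) auto
      finally show "\<eta>' (?V x xh) \<le> (\<Sum>i<N. \<mu> i * \<eta> i (V i (?x i) (?xh i)))" .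
      \<comment> \<open>Each component of the input has norm at most \<open>vnorm uh\<close>, and
        every \<open>\<rho> i\<close> is monotone, also when it is the zero function.\<close>
      show "(\<Sum>i<N. \<mu> i * \<rho> i (vnorm (?uh i))) \<le> \<rho>' (vnorm uh)"
        unfolding \<rho>'_def using \<mu> vnorm_vec_block_le[OF uh] class_Kinf_or_zero_mono[OF \<rho>]
        by (intro sum_mono mult_left_mono) (auto simp: less_imp_le)
      show "(\<Sum>i<N. \<mu> i * ?Q i) \<le> 0"
        by (rule dissipative[of ?y ?yh]) (auto simp: z_def intro!: h2 assms(5,6) xc xhc)
    qed
    finally show ?thesis
      using concat_vecs_carrier[of N u ?m] u by (intro bexI[of _ "concat_vecs N u"]) auto
  qed

  \<comment> \<open>Assembling the simulation function\<close>
  let ?I = "interconnection N S M" and ?Ih = "interconnection N Sh Mh"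
  have dims: "cn_of ?I = (\<Sum>i<N. ?n i)" "cn_of ?Ih = (\<Sum>i<N. ?nh i)"
    "cm_of ?Ih = (\<Sum>i<N. ?mh i)" "cm_of ?I = (\<Sum>i<N. ?m i)"
    by (simp_all add: interconnection_def)
  show ?thesis
    unfolding simulation_function_def
  proof (intro conjI)
    show "cq_of ?Ih = cq_of ?I"
      using q1 by (simp add: interconnection_def)
    show "\<forall>x\<in>carrier_vec (cn_of ?I). \<forall>xh\<in>carrier_vec (cn_of ?Ih). 0 \<le> ?V x xh"
      using V_nonneg[OF _ xc xhc] \<mu> by (intro ballI sum_nonneg mult_nonneg_nonneg) (auto simp: less_imp_le)
    show "cont_differentiable (cn_of ?I + cn_of ?Ih) (on_concat (cn_of ?I) (cn_of ?Ih) ?V)"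
      unfolding dims by (intro cont_differentiable_on_concat_sum V_diff)
    have "\<alpha>' (vnorm (ch_of ?I x - ch_of ?Ih xh)) \<le> ?V x xh" for x xh
      using lower by (simp add: interconnection_def)
    moreover have "\<exists>u\<in>carrier_vec (cm_of ?I).
        gradient (cn_of ?I + cn_of ?Ih)
          (on_concat (cn_of ?I) (cn_of ?Ih) ?V) (x @\<^sub>v xh) \<bullet>
          (cf_of ?I x u @\<^sub>v cf_of ?Ih xh uh)
        \<le> - \<eta>' (?V x xh) + \<rho>' (vnorm uh)"
      if "x \<in> carrier_vec (cn_of ?I)" "xh \<in> carrier_vec (cn_of ?Ih)"
        "uh \<in> carrier_vec (cm_of ?Ih)" for x xh uh
      using main that unfolding dims .
    ultimately show "\<exists>\<alpha> \<eta> \<rho>. class_Kinf \<alpha> \<and> class_Kinf \<eta> \<and> class_Kinf_or_zero \<rho> \<and>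
       (\<forall>x\<in>carrier_vec (cn_of ?I). \<forall>xh\<in>carrier_vec (cn_of ?Ih).
          \<alpha> (vnorm (ch_of ?I x - ch_of ?Ih xh)) \<le> ?V x xh \<and>
          (\<forall>uh\<in>carrier_vec (cm_of ?Ih). \<exists>u\<in>carrier_vec (cm_of ?I).
             gradient (cn_of ?I + cn_of ?Ih) (on_concat (cn_of ?I) (cn_of ?Ih) ?V) (x @\<^sub>v xh) \<bullet>
               (cf_of ?I x u @\<^sub>v cf_of ?Ih xh uh)
             \<le> - \<eta> (?V x xh) + \<rho> (vnorm uh)))"
      using \<alpha>' \<eta>' \<rho>' by blast
  qed
qed

end
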